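(* For each integer $\alpha \geq 5$, let \[ \Gamma_1 = \Gamma^{2^{\alpha-1}, 2^{\alpha}}(-1 + 2^{\alpha-2},\ -3 + 2^{\alpha-2},\ 1 + 2^{\alpha-2},\ 3 + 2^{\alpha-2}), \qquad \Gamma_2 = \Gamma^{2^{\alpha}, 8}(-1 + 2^{\alpha-2},\ -3,\ 1 + 2^{\alpha-2},\ 3). \] Then the mix $\Gamma_1 \diamond \Gamma_2$ is the automorphism group of a tight chiral polyhedron of type $\{2^{\alpha}, 2^{\alpha}\}$.
   Context: For integers $p,q,i_1,j_1,i_2,j_2$, $\Gamma^{p,q}(i_1,j_1,i_2,j_2)$ denotes the group with presentation $\langle \sigma_1,\sigma_2 \mid \sigma_1^p=\sigma_2^q=(\sigma_1\sigma_2)^2=1,\ \sigma_2^{-1}\sigma_1=\sigma_1^{i_1}\sigma_2^{j_1},\ \sigma_2\sigma_1^{-1}=\sigma_1^{i_2}\sigma_2^{j_2}\rangle$. For groups $\Gamma=\langle\sigma_1,\sigma_2\rangle$ and $\Gamma'=\langle\sigma_1',\sigma_2'\rangle$, the mix $\Gamma\diamond\Gamma'$ is the subgroup of $\Gamma\times\Gamma'$ generated by $\alpha_1=(\sigma_1,\sigma_1')$ and $\alpha_2=(\sigma_2,\sigma_2')$, with distinguished generators $\alpha_1,\alpha_2$. An (abstract) polyhedron is a partially ordered set whose elements have rank $0$, $1$, $2$ (vertices, edges, faces), incidence meaning comparability, such that every edge is incident to exactly two vertices and two faces, whenever a vertex is incident to a face exactly two edges are incident to both, the incidence graph is connected, and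 for each vertex or face the subgraph of the incidence graph induced on its neighbours is connected. A flag is a mutually incident (vertex, edge, face) triple; $\Phi^i$ is the flag differing from $\Phi$ exactly in its rank-$i$ element. Type $\{p,q\}$: faces are incident to $p$ edges and vertices to $q$ edges. The polyhedron is chiral if its flags split into two classes with $\Phi,\Phi^i$ always in different classes and the automorphism group transitive on each class but not on all flags; then, fixing a base flag $\Phi$, the automorphism group is generated by $\sigma_1:\Phi\mapsto(\Phi^1)^0$ and $\sigma_2:\Phi\mapsto(\Phi^2)^1$. A group with two distinguished generators "is the automorphism group of" such a polyhedron if there is an isomorphism onto it sending the distinguished generators to $\sigma_1,\sigma_2$ respectively. A polyhedron of type $\{p,q\}$ is tight if it has exactly $2pq$ flags. *)

theory Defs
  imports "HOL-Algebra.Generated_Groups" "HOL-Algebra.Bij"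
begin

section \<open>Groups given by a presentation\<close>

text \<open>
  A word is a list of letters; the letter \<open>(x, True)\<close> stands for the generator \<open>x\<close> and
  \<open>(x, False)\<close> for its inverse.
\<close>

type_synonym 'g word = "('g \<times> bool) list"

inductive word_eq :: "('g word \<times> 'g word) set \<Rightarrow> 'g word \<Rightarrow> 'g word \<Rightarrow> bool"
  for R where
  refl: "word_eq R u u"
| sym: "word_eq R u v \<Longrightarrow> word_eq R v u"
| trans: "word_eq R u v \<Longrightarrow> word_eq R v w \<Longrightarrow> word_eq R u w"
| cancel: "word_eq R (u @ [(x, b), (x, \<not> b)] @ v) (u @ v)"
| rel: "(l, r) \<in> R \<Longrightarrow> word_eq R (u @ l @ v) (u @ r @ v)"

definition word_class :: "('g word \<times> 'g word) set \<Rightarrow> 'g word \<Rightarrow> 'g word set" where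
  "word_class R u = {v. word_eq R u v}"

definition presented_group :: "('g word \<times> 'g word) set \<Rightarrow> 'g word set monoid" where
  "presented_group R =
     \<lparr>carrier = range (word_class R),
      mult = (\<lambda>A B. \<Union>u\<in>A. \<Union>v\<in>B. word_class R (u @ v)),
      one = word_class R []\<rparr>"

lemma word_class_eq_iff: "word_class R u = word_class R v \<longleftrightarrow> word_eq R u v"
  unfolding word_class_def set_eq_iff mem_Collect_eq
  by (meson word_eq.refl word_eq.sym word_eq.trans)

lemma word_eq_append_left: "word_eq R u v \<Longrightarrow> word_eq R (w @ u) (w @ v)"
proof (induction rule: word_eq.induct)
  case (cancel u x b v)
  show ?case using word_eq.cancel[of R "w @ u" x b v] by simp
next
  case (rel l r u v)
  then show ?case using word_eq.rel[of l r R "w @ u" v] by simp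
qed (rule word_eq.refl, erule word_eq.sym, erule (1) word_eq.trans)

lemma word_eq_append_right: "word_eq R u v \<Longrightarrow> word_eq R (u @ w) (v @ w)"
proof (induction rule: word_eq.induct)
  case (cancel u x b v)
  show ?case using word_eq.cancel[of R u x b "v @ w"] by simp
next
  case (rel l r u v)
  then show ?case using word_eq.rel[of l r R u "v @ w"] by simp
qed (rule word_eq.refl, erule word_eq.sym, erule (1) word_eq.trans)

lemma word_eq_append:
  "word_eq R u u' \<Longrightarrow> word_eq R v v' \<Longrightarrow> word_eq R (u @ v) (u' @ v')"
  by (rule word_eq.trans[OF word_eq_append_right word_eq_append_left])

lemma presented_group_mult:
  "word_class R u \<otimes>\<^bsub>presented_group R\<^esub> word_class R v = word_class R (u @ v)"
proof -
  have *: "word_class R (u' @ v') = word_class R (u @ v)"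
    if "u' \<in> word_class R u" "v' \<in> word_class R v" for u' v'
    using that unfolding word_class_eq_iff
    by (simp add: word_class_def word_eq_append word_eq.sym)
  have "u \<in> word_class R u" "v \<in> word_class R v"
    by (simp_all add: word_class_def word_eq.refl)
  then have "(\<Union>u'\<in>word_class R u. \<Union>v'\<in>word_class R v. word_class R (u' @ v')) = word_class R (u @ v)"
    using * by blast
  then show ?thesis by (simp add: presented_group_def)
qed

lemma word_eq_inverse:
  "word_eq R (rev (map (\<lambda>(x, b). (x, \<not> b)) u) @ u) []"
proof (induction u)
  case Nil
  show ?case by (simp add: word_eq.refl)
next
  case (Cons a u)
  obtain x b where a: "a = (x, b)" by (cases a)
  show ?case
    using word_eq.trans[OF word_eq.cancel[of R "rev (map (\<lambda>(x, b). (x, \<not> b)) u)" x "\<not> b" u]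
        Cons.IH] a by simp
qed

lemma group_presented_group: "group (presented_group R)"
proof (rule groupI)
  fix A assume "A \<in> carrier (presented_group R)"
  then obtain u where A: "A = word_class R u" by (auto simp: presented_group_def)
  show "\<exists>B\<in>carrier (presented_group R). B \<otimes>\<^bsub>presented_group R\<^esub> A = \<one>\<^bsub>presented_group R\<^esub>"
  proof (rule bexI)
    show "word_class R (rev (map (\<lambda>(x, b). (x, \<not> b)) u)) \<otimes>\<^bsub>presented_group R\<^esub> A
      = \<one>\<^bsub>presented_group R\<^esub>"
      unfolding A presented_group_mult
      by (simp add: presented_group_def word_class_eq_iff word_eq_inverse)
  qed (simp add: presented_group_def)
next
  fix A assume "A \<in> carrier (presented_group R)"
  then obtain u where A: "A = word_class R u" by (auto simp: presented_group_def)
  have one: "\<one>\<^bsub>presented_group R\<^esub> = word_class R []" by (simp add: presented_group_def)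
  show "\<one>\<^bsub>presented_group R\<^esub> \<otimes>\<^bsub>presented_group R\<^esub> A = A"
    unfolding A one presented_group_mult by simp
next
  fix A B assume "A \<in> carrier (presented_group R)" "B \<in> carrier (presented_group R)"
  then obtain u v where AB: "A = word_class R u" "B = word_class R v"
    by (auto simp: presented_group_def)
  show "A \<otimes>\<^bsub>presented_group R\<^esub> B \<in> carrier (presented_group R)"
    unfolding AB presented_group_mult by (simp add: presented_group_def)
next
  fix A B C
  assume "A \<in> carrier (presented_group R)" "B \<in> carrier (presented_group R)"
    "C \<in> carrier (presented_group R)"
  then obtain u v w where "A = word_class R u" "B = word_class R v" "C = word_class R w"
    by (auto simp: presented_group_def)
  then show "A \<otimes>\<^bsub>presented_group R\<^esub> B \<otimes>\<^bsub>presented_group R\<^esub> C =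
      A \<otimes>\<^bsub>presented_group R\<^esub> (B \<otimes>\<^bsub>presented_group R\<^esub> C)"
    by (simp add: presented_group_mult)
qed (simp add: presented_group_def)


section \<open>Groups with two distinguished generators, and their mix\<close>

type_synonym 'a gen_group = "'a monoid \<times> 'a \<times> 'a"

datatype gen = Sigma1 | Sigma2

definition gen_pow :: "'g \<Rightarrow> int \<Rightarrow> 'g word" where
  "gen_pow x k = replicate (nat \<bar>k\<bar>) (x, 0 \<le> k)"

definition Gamma_rels :: "int \<Rightarrow> int \<Rightarrow> int \<Rightarrow> int \<Rightarrow> int \<Rightarrow> int \<Rightarrow> (gen word \<times> gen word) set" where
  "Gamma_rels p q i1 j1 i2 j2 =
     {(gen_pow Sigma1 p, []),
      (gen_pow Sigma2 q, []),
      ([(Sigma1, True), (Sigma2, True), (Sigma1, True), (Sigma2, True)], []),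
      ([(Sigma2, False), (Sigma1, True)], gen_pow Sigma1 i1 @ gen_pow Sigma2 j1),
      ([(Sigma2, True), (Sigma1, False)], gen_pow Sigma1 i2 @ gen_pow Sigma2 j2)}"

definition Gamma :: "int \<Rightarrow> int \<Rightarrow> int \<Rightarrow> int \<Rightarrow> int \<Rightarrow> int \<Rightarrow> gen word set gen_group" where
  "Gamma p q i1 j1 i2 j2 =
     (let R = Gamma_rels p q i1 j1 i2 j2
      in (presented_group R, word_class R [(Sigma1, True)], word_class R [(Sigma2, True)]))"

fun mix :: "'a gen_group \<Rightarrow> 'b gen_group \<Rightarrow> ('a \<times> 'b) gen_group" (infixl "\<diamondop>" 70) where
  "(G, s1, s2) \<diamondop> (H, t1, t2) =
     (subgroup_generated (G \<times>\<times> H) {(s1, t1), (s2, t2)}, (s1, t1), (s2, t2))"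


section \<open>Abstract polyhedra\<close>

record 'a ranked_poset =
  elems :: "'a set"
  order_rel :: "'a rel"
  rank :: "'a \<Rightarrow> nat"

definition of_rank :: "'a ranked_poset \<Rightarrow> nat \<Rightarrow> 'a set" where
  "of_rank K i = {x \<in> elems K. rank K x = i}"

definition incident :: "'a ranked_poset \<Rightarrow> 'a \<Rightarrow> 'a \<Rightarrow> bool" where
  "incident K x y \<longleftrightarrow> (x, y) \<in> order_rel K \<or> (y, x) \<in> order_rel K"

definition neighbours :: "'a ranked_poset \<Rightarrow> 'a \<Rightarrow> 'a set" where
  "neighbours K x = {y \<in> elems K. y \<noteq> x \<and> incident K x y}"

text \<open>Connectedness of the subgraph of the incidence graph induced on \<open>S\<close>.\<close>

definition incidence_connected :: "'a ranked_poset \<Rightarrow> 'a set \<Rightarrow> bool" where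
  "incidence_connected K S \<longleftrightarrow>
     (\<forall>x\<in>S. \<forall>y\<in>S. (x, y) \<in> {(u, v). u \<in> S \<and> v \<in> S \<and> incident K u v}\<^sup>*)"

definition polyhedron :: "'a ranked_poset \<Rightarrow> bool" where
  "polyhedron K \<longleftrightarrow>
     partial_order_on (elems K) (order_rel K) \<and>
     elems K \<noteq> {} \<and>
     (\<forall>x\<in>elems K. rank K x \<in> {0, 1, 2}) \<and>
     (\<forall>(x, y)\<in>order_rel K. x \<noteq> y \<longrightarrow> rank K x < rank K y) \<and>
     (\<forall>e\<in>of_rank K 1. card {v \<in> of_rank K 0. incident K v e} = 2 \<and>
                      card {f \<in> of_rank K 2. incident K e f} = 2) \<and>
     (\<forall>v\<in>of_rank K 0. \<forall>f\<in>of_rank K 2. incident K v f \<longrightarrow>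
        card {e \<in> of_rank K 1. incident K v e \<and> incident K e f} = 2) \<and>
     incidence_connected K (elems K) \<and>
     (\<forall>x\<in>of_rank K 0 \<union> of_rank K 2. incidence_connected K (neighbours K x))"

definition has_type :: "'a ranked_poset \<Rightarrow> nat \<Rightarrow> nat \<Rightarrow> bool" where
  "has_type K p q \<longleftrightarrow>
     (\<forall>f\<in>of_rank K 2. finite {e \<in> of_rank K 1. incident K e f} \<and>
                      card {e \<in> of_rank K 1. incident K e f} = p) \<and>
     (\<forall>v\<in>of_rank K 0. finite {e \<in> of_rank K 1. incident K v e} \<and>
                      card {e \<in> of_rank K 1. incident K v e} = q)"

type_synonym 'a flag = "'a \<times> 'a \<times> 'a"

definition flags :: "'a ranked_poset \<Rightarrow> 'a flag set" where
  "flags K = {(v, e, f). v \<in> of_rank K 0 \<and> e \<in> of_rank K 1 \<and> f \<in> of_rank K 2 \<and>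
                         incident K v e \<and> incident K e f \<and> incident K v f}"

fun flag_elem :: "'a flag \<Rightarrow> nat \<Rightarrow> 'a" where
  "flag_elem (v, e, f) i = (if i = 0 then v else if i = 1 then e else f)"

text \<open>The flag \<open>\<Phi>\<^sup>i\<close>; it exists and is unique when \<open>K\<close> is a polyhedron, \<open>\<Phi>\<close> is a flag of \<open>K\<close>
  and \<open>i \<le> 2\<close>.\<close>

definition adj_flag :: "'a ranked_poset \<Rightarrow> nat \<Rightarrow> 'a flag \<Rightarrow> 'a flag" where
  "adj_flag K i \<Phi> =
     (THE \<Psi>. \<Psi> \<in> flags K \<and> (\<forall>j\<in>{0, 1, 2}. flag_elem \<Psi> j \<noteq> flag_elem \<Phi> j \<longleftrightarrow> j = i))"

text \<open>The product is that of automorphisms acting on the right: \<open>g \<otimes> h\<close> is \<open>g\<close> followed by \<open>h\<close>.\<close>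

definition aut_group :: "'a ranked_poset \<Rightarrow> ('a \<Rightarrow> 'a) monoid" where
  "aut_group K =
     \<lparr>carrier = {g \<in> Bij (elems K). \<forall>x\<in>elems K. \<forall>y\<in>elems K.
                   (x, y) \<in> order_rel K \<longleftrightarrow> (g x, g y) \<in> order_rel K},
      mult = (\<lambda>g h. compose (elems K) h g),
      one = (\<lambda>x\<in>elems K. x)\<rparr>"

fun flag_image :: "('a \<Rightarrow> 'a) \<Rightarrow> 'a flag \<Rightarrow> 'a flag" where
  "flag_image g (v, e, f) = (g v, g e, g f)"

definition flag_transitive_on :: "'a ranked_poset \<Rightarrow> 'a flag set \<Rightarrow> bool" where
  "flag_transitive_on K A \<longleftrightarrow>
     (\<forall>\<Phi>\<in>A. \<forall>\<Psi>\<in>A. \<exists>g\<in>carrier (aut_group K). flag_image g \<Phi> = \<Psi>)"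

definition chiral :: "'a ranked_poset \<Rightarrow> bool" where
  "chiral K \<longleftrightarrow> polyhedron K \<and>
     (\<exists>A B. A \<union> B = flags K \<and> A \<inter> B = {} \<and> A \<noteq> {} \<and> B \<noteq> {} \<and>
        (\<forall>\<Phi>\<in>flags K. \<forall>i\<in>{0, 1, 2}. \<Phi> \<in> A \<longleftrightarrow> adj_flag K i \<Phi> \<in> B) \<and>
        flag_transitive_on K A \<and> flag_transitive_on K B) \<and>
     \<not> flag_transitive_on K (flags K)"

definition tight :: "'a ranked_poset \<Rightarrow> nat \<Rightarrow> nat \<Rightarrow> bool" where
  "tight K p q \<longleftrightarrow> polyhedron K \<and> has_type K p q \<and>
     finite (flags K) \<and> card (flags K) = 2 * p * q"

text \<open>The base flag is part of the choice of \<open>\<sigma>\<^sub>1, \<sigma>\<^sub>2\<close>: the two flag classes of a chiral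
  polyhedron give inequivalent pairs of generators.\<close>

fun is_aut_group_of :: "'b gen_group \<Rightarrow> 'a ranked_poset \<Rightarrow> bool" where
  "is_aut_group_of (G, a1, a2) K \<longleftrightarrow>
     (\<exists>\<Phi>\<in>flags K. \<exists>h\<in>iso G (aut_group K).
        flag_image (h a1) \<Phi> = adj_flag K 0 (adj_flag K 1 \<Phi>) \<and>
        flag_image (h a2) \<Phi> = adj_flag K 1 (adj_flag K 2 \<Phi>))"

end

theory Submission
  imports Defs "HOL-Library.Countable_Set" "HOL-Number_Theory.Cong"
begin

text \<open>
  Put \<open>N = 2\<^sup>\<alpha>\<^sup>-\<^sup>2\<close>. The generators \<open>s, t\<close> of the mix satisfy \<open>t\<^sup>-\<^sup>1 s = s\<^sup>-\<^sup>1\<^sup>+\<^sup>N t\<^sup>-\<^sup>3\<^sup>+\<^sup>N\<close> and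
  \<open>t s\<^sup>-\<^sup>1 = s\<^sup>1\<^sup>+\<^sup>N t\<^sup>3\<^sup>+\<^sup>N\<close>. These relations force \<open>s\<^sup>N\<close> to commute with \<open>t\<^sup>6\<close>, hence with \<open>t\<^sup>2\<close>, and then
  every element is a product \<open>s\<^sup>i t\<^sup>j\<close>. The group \<open>\<Gamma>\<^sub>1\<close> acts on the integers modulo \<open>4 N\<close> with \<open>\<sigma>\<^sub>2\<close> as the
  translation by 1 and \<open>\<sigma>\<^sub>1\<close> fixing 0, and \<open>\<Gamma>\<^sub>2\<close> acts likewise with the generators exchanged, so
  \<open>s\<^sup>i = t\<^sup>j\<close> only if \<open>4 N\<close> divides both \<open>i\<close> and \<open>j\<close>. Therefore the right cosets of \<open>\<langle>t\<rangle>\<close>, \<open>\<langle>s t\<rangle>\<close> and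
  \<open>\<langle>s\<rangle>\<close> are the vertices, edges and faces of a tight polyhedron in which all vertices are incident to all
  faces. A reflection would turn the first relation into \<open>t s\<^sup>-\<^sup>1 = s\<^sup>1\<^sup>-\<^sup>N t\<^sup>3\<^sup>-\<^sup>N\<close>, contradicting the second
  because \<open>2 N\<close> is not divisible by \<open>4 N\<close>.
\<close>

section \<open>Permutation representations of presented groups\<close>

lemma presented_group_nat_pow:
  "word_class R w [^]\<^bsub>presented_group R\<^esub> (n::nat) = word_class R (concat (replicate n w))"
proof (induction n)
  case 0
  interpret group "presented_group R" by (rule group_presented_group)
  show ?case by (simp add: presented_group_def)
next
  case (Suc n)
  interpret group "presented_group R" by (rule group_presented_group)
  have "concat (replicate n w) @ w = w @ concat (replicate n w)" by (induction n) simp_all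
  then show ?case using Suc by (simp add: presented_group_mult)
qed

lemma presented_group_inv:
  "inv\<^bsub>presented_group R\<^esub> (word_class R w) = word_class R (rev (map (\<lambda>(x, b). (x, \<not> b)) w))"
proof -
  interpret group "presented_group R" by (rule group_presented_group)
  show ?thesis
  proof (rule inv_equality)
    show "word_class R (rev (map (\<lambda>(x, b). (x, \<not> b)) w)) \<otimes>\<^bsub>presented_group R\<^esub> word_class R w
      = \<one>\<^bsub>presented_group R\<^esub>"
      unfolding presented_group_mult
      by (simp add: presented_group_def word_class_eq_iff word_eq_inverse)
  qed (simp_all add: presented_group_def)
qed

lemma concat_replicate_singleton: "concat (replicate n [x]) = replicate n x"
  by (induction n) simp_all

lemma word_class_carrier [simp]: "word_class R w \<in> carrier (presented_group R)"
  by (simp add: presented_group_def)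

lemma word_class_gen_pow:
  "word_class R (gen_pow x k) = word_class R [(x, True)] [^]\<^bsub>presented_group R\<^esub> k"
proof -
  interpret group "presented_group R" by (rule group_presented_group)
  have nat: "word_class R [(x, True)] [^]\<^bsub>presented_group R\<^esub> n = word_class R (replicate n (x, True))"
    for n :: nat
    by (simp only: presented_group_nat_pow concat_replicate_singleton)
  show ?thesis
  proof (cases "k \<ge> 0")
    case True
    then obtain n where "k = int n" by (metis nonneg_int_cases)
    then show ?thesis by (simp add: gen_pow_def int_pow_int nat)
  next
    case False
    then obtain n where n: "k = - int n" "n > 0" by (metis neg_int_cases not_le)
    have "word_class R [(x, True)] [^]\<^bsub>presented_group R\<^esub> k
      = inv\<^bsub>presented_group R\<^esub> (word_class R (replicate n (x, True)))"
      unfolding n(1) by (simp add: int_pow_neg int_pow_int nat)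
    then show ?thesis using n by (simp add: presented_group_inv gen_pow_def)
  qed
qed

lemma presented_group_rel:
  "(l, r) \<in> R \<Longrightarrow> word_class R l = word_class R r"
  using word_eq.rel[of l r R "[]" "[]"] by (simp add: word_class_eq_iff)

lemma Gamma_relations:
  fixes p q i1 j1 i2 j2 :: int
  defines "R \<equiv> Gamma_rels p q i1 j1 i2 j2"
  defines "s \<equiv> word_class R [(Sigma1, True)]" and "t \<equiv> word_class R [(Sigma2, True)]"
  shows "s [^]\<^bsub>presented_group R\<^esub> p = \<one>\<^bsub>presented_group R\<^esub>"
    and "t [^]\<^bsub>presented_group R\<^esub> q = \<one>\<^bsub>presented_group R\<^esub>"
    and "(s \<otimes>\<^bsub>presented_group R\<^esub> t) \<otimes>\<^bsub>presented_group R\<^esub> (s \<otimes>\<^bsub>presented_group R\<^esub> t)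
      = \<one>\<^bsub>presented_group R\<^esub>"
    and "inv\<^bsub>presented_group R\<^esub> t \<otimes>\<^bsub>presented_group R\<^esub> s
      = s [^]\<^bsub>presented_group R\<^esub> i1 \<otimes>\<^bsub>presented_group R\<^esub> t [^]\<^bsub>presented_group R\<^esub> j1"
    and "t \<otimes>\<^bsub>presented_group R\<^esub> inv\<^bsub>presented_group R\<^esub> s
      = s [^]\<^bsub>presented_group R\<^esub> i2 \<otimes>\<^bsub>presented_group R\<^esub> t [^]\<^bsub>presented_group R\<^esub> j2"
proof -
  have one: "\<one>\<^bsub>presented_group R\<^esub> = word_class R []" by (simp add: presented_group_def)
  note simps = s_def t_def one word_class_gen_pow[symmetric] presented_group_mult presented_group_inv
  have mem: "(gen_pow Sigma1 p, []) \<in> R" "(gen_pow Sigma2 q, []) \<in> R"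
    "([(Sigma1, True), (Sigma2, True), (Sigma1, True), (Sigma2, True)], []) \<in> R"
    "([(Sigma2, False), (Sigma1, True)], gen_pow Sigma1 i1 @ gen_pow Sigma2 j1) \<in> R"
    "([(Sigma2, True), (Sigma1, False)], gen_pow Sigma1 i2 @ gen_pow Sigma2 j2) \<in> R"
    unfolding R_def Gamma_rels_def by simp_all
  note rels = mem[THEN presented_group_rel]
  show "s [^]\<^bsub>presented_group R\<^esub> p = \<one>\<^bsub>presented_group R\<^esub>" using rels(1) by (simp add: simps)
  show "t [^]\<^bsub>presented_group R\<^esub> q = \<one>\<^bsub>presented_group R\<^esub>" using rels(2) by (simp add: simps)
  show "(s \<otimes>\<^bsub>presented_group R\<^esub> t) \<otimes>\<^bsub>presented_group R\<^esub> (s \<otimes>\<^bsub>presented_group R\<^esub> t)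
      = \<one>\<^bsub>presented_group R\<^esub>" using rels(3) by (simp add: simps)
  show "inv\<^bsub>presented_group R\<^esub> t \<otimes>\<^bsub>presented_group R\<^esub> s
      = s [^]\<^bsub>presented_group R\<^esub> i1 \<otimes>\<^bsub>presented_group R\<^esub> t [^]\<^bsub>presented_group R\<^esub> j1"
    using rels(4) by (simp add: simps)
  show "t \<otimes>\<^bsub>presented_group R\<^esub> inv\<^bsub>presented_group R\<^esub> s
      = s [^]\<^bsub>presented_group R\<^esub> i2 \<otimes>\<^bsub>presented_group R\<^esub> t [^]\<^bsub>presented_group R\<^esub> j2"
    using rels(5) by (simp add: simps)
qed

section \<open>Words acting on the integers modulo \<open>m\<close>\<close>

lemma word_eq_foldr_cong:
  fixes A :: "'g \<times> bool \<Rightarrow> int \<Rightarrow> int"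
  assumes resp: "\<And>l x y. [x = y] (mod m) \<Longrightarrow> [A l x = A l y] (mod m)"
    and inverse: "\<And>g b x. [A (g, b) (A (g, \<not> b) x) = x] (mod m)"
    and rels: "\<And>l r x. (l, r) \<in> R \<Longrightarrow> [foldr A l x = foldr A r x] (mod m)"
    and "word_eq R u v"
  shows "[foldr A u x = foldr A v x] (mod m)"
proof -
  \<comment> \<open>A congruence between arguments survives any word, so a change in the middle of a
    word can be followed through the prefix that acts after it.\<close>
  have foldr_cong: "[foldr A w x = foldr A w y] (mod m)" if "[x = y] (mod m)" for w x y
    using that by (induction w) (auto intro: resp)
  show ?thesis
    using \<open>word_eq R u v\<close>
  proof (induction arbitrary: x rule: word_eq.induct)
    case (cancel u g b v)
    show ?case using foldr_cong[OF inverse] by simp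
  next
    case (rel l r u v)
    show ?case using foldr_cong[OF rels[OF rel]] by simp
  qed (auto intro: cong_sym cong_trans)
qed

text \<open>\<open>P k\<close> and \<open>Q k\<close> are the actions of the \<open>k\<close>-th powers of the two generators
  on the integers modulo \<open>m\<close>.\<close>

locale Gamma_model =
  fixes p q i1 j1 i2 j2 m :: int and P Q :: "int \<Rightarrow> int \<Rightarrow> int"
  assumes P_cong: "\<And>k x y. [x = y] (mod m) \<Longrightarrow> [P k x = P k y] (mod m)"
    and Q_cong: "\<And>k x y. [x = y] (mod m) \<Longrightarrow> [Q k x = Q k y] (mod m)"
    and P_add: "\<And>a b x. [P a (P b x) = P (a + b) x] (mod m)"
    and Q_add: "\<And>a b x. [Q a (Q b x) = Q (a + b) x] (mod m)"
    and P_0: "\<And>x. P 0 x = x" and Q_0: "\<And>x. Q 0 x = x"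
    and P_p: "\<And>x. [P p x = x] (mod m)" and Q_q: "\<And>x. [Q q x = x] (mod m)"
    and PQPQ: "\<And>x. [P 1 (Q 1 (P 1 (Q 1 x))) = x] (mod m)"
    and rel1: "\<And>x. [Q (-1) (P 1 x) = P i1 (Q j1 x)] (mod m)"
    and rel2: "\<And>x. [Q 1 (P (-1) x) = P i2 (Q j2 x)] (mod m)"
begin

definition X :: "gen \<Rightarrow> int \<Rightarrow> int \<Rightarrow> int" where "X g = (case g of Sigma1 \<Rightarrow> P | Sigma2 \<Rightarrow> Q)"

definition letter :: "gen \<times> bool \<Rightarrow> int \<Rightarrow> int" where
  "letter l = X (fst l) (if snd l then 1 else -1)"

lemma X_cong: "[x = y] (mod m) \<Longrightarrow> [X g k x = X g k y] (mod m)"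
  and X_add: "[X g a (X g b x) = X g (a + b) x] (mod m)"
  and X_0: "X g 0 x = x"
  using P_cong Q_cong P_add Q_add P_0 Q_0 by (cases g; simp add: X_def)+

lemma foldr_gen_pow: "[foldr letter (gen_pow g k) x = X g k x] (mod m)"
proof -
  have "[foldr letter (replicate n (g, b)) x = X g (if b then int n else - int n) x] (mod m)" for n b
  proof (induction n)
    case (Suc n)
    let ?e = "if b then 1 else - 1"
    have "[foldr letter (replicate (Suc n) (g, b)) x = X g ?e (X g (if b then int n else - int n) x)] (mod m)"
      using X_cong[OF Suc] by (simp add: letter_def)
    also have "[X g ?e (X g (if b then int n else - int n) x)
      = X g (?e + (if b then int n else - int n)) x] (mod m)"
      by (rule X_add)
    finally show ?case by (cases b) simp_all
  qed (simp add: X_0)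
  from this[of "nat \<bar>k\<bar>" "0 \<le> k"] show ?thesis
    by (cases "k \<ge> 0") (simp_all add: gen_pow_def)
qed

lemma foldr_gen_pow2:
  "[foldr letter (gen_pow g k @ gen_pow h l) x = X g k (X h l x)] (mod m)"
  using foldr_gen_pow[of g k "foldr letter (gen_pow h l) x"] X_cong[OF foldr_gen_pow[of h l x], of g k]
  by (simp add: cong_trans)

text \<open>Both powers are read as words, and equal words act alike on every residue. At a point
  fixed by one generator the conclusion turns an equation between powers into a divisibility of one
  exponent.\<close>

lemma gen_pow_eq_imp_cong:
  assumes "word_class (Gamma_rels p q i1 j1 i2 j2) (gen_pow Sigma1 i)
    = word_class (Gamma_rels p q i1 j1 i2 j2) (gen_pow Sigma2 j)"
  shows "[P i x = Q j x] (mod m)"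
proof -
  have "[foldr letter (gen_pow Sigma1 i) x = foldr letter (gen_pow Sigma2 j) x] (mod m)"
  proof (rule word_eq_foldr_cong)
    show "word_eq (Gamma_rels p q i1 j1 i2 j2) (gen_pow Sigma1 i) (gen_pow Sigma2 j)"
      using assms by (simp add: word_class_eq_iff)
    show "[x = y] (mod m) \<Longrightarrow> [letter l x = letter l y] (mod m)" for l x y
      by (simp add: letter_def X_cong)
    show "[letter (g, b) (letter (g, \<not> b) x) = x] (mod m)" for g b x
      using X_add[of g 1 "-1" x] X_add[of g "-1" 1 x] by (cases b) (simp_all add: letter_def X_0)
    show "[foldr letter l x = foldr letter r x] (mod m)" if lr: "(l, r) \<in> Gamma_rels p q i1 j1 i2 j2" for l r x
    proof -
      consider "l = gen_pow Sigma1 p" "r = []" | "l = gen_pow Sigma2 q" "r = []"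
        | "l = [(Sigma1, True), (Sigma2, True), (Sigma1, True), (Sigma2, True)]" "r = []"
        | "l = [(Sigma2, False), (Sigma1, True)]" "r = gen_pow Sigma1 i1 @ gen_pow Sigma2 j1"
        | "l = [(Sigma2, True), (Sigma1, False)]" "r = gen_pow Sigma1 i2 @ gen_pow Sigma2 j2"
        using lr by (auto simp: Gamma_rels_def)
      then show ?thesis
      proof cases
        case 1
        then show ?thesis using cong_trans[OF foldr_gen_pow[of Sigma1 p x]] P_p by (simp add: X_def)
      next
        case 2
        then show ?thesis using cong_trans[OF foldr_gen_pow[of Sigma2 q x]] Q_q by (simp add: X_def)
      next
        case 3
        then show ?thesis using PQPQ by (simp add: letter_def X_def)
      next
        case 4
        then show ?thesis
          using cong_trans[OF _ cong_sym[OF foldr_gen_pow2[of Sigma1 i1 Sigma2 j1 x]]] rel1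
          by (simp add: letter_def X_def)
      next
        case 5
        then show ?thesis
          using cong_trans[OF _ cong_sym[OF foldr_gen_pow2[of Sigma1 i2 Sigma2 j2 x]]] rel2
          by (simp add: letter_def X_def)
      qed
    qed
  qed
  then show ?thesis
    using foldr_gen_pow[of Sigma1 i x] foldr_gen_pow[of Sigma2 j x]
    by (simp add: X_def) (meson cong_sym cong_trans)
qed

end

section \<open>The explicit actions of the two groups\<close>

lemma cong_by_diff: "u - v = m * k \<Longrightarrow> [u = v] (mod m)" for u v m k :: int
  by (simp add: cong_iff_dvd_diff)

text \<open>The action of \<open>\<sigma>\<^sub>1\<^sup>n\<close> on the cosets \<open>\<sigma>\<^sub>2\<^sup>y \<langle>\<sigma>\<^sub>1\<rangle>\<close> in \<open>\<Gamma>\<^sub>1\<close>, where \<open>2\<^sup>\<alpha> = 32 M\<close>.\<close>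

definition face_action :: "int \<Rightarrow> int \<Rightarrow> int \<Rightarrow> int" where
  "face_action M n y = (if even y then y - 4 * n * M * y else y - 2 * n + 4 * M * n * (y - n))"

lemma face_action_0: "face_action M n 0 = 0"
  by (simp add: face_action_def)

text \<open>\<open>face_action\<close> preserves the parity of the point, so all three applications
  use the same branch. For even \<open>y\<close> the two sides differ by
  \<open>16 * M^2 * a * b * y\<close>, for odd \<open>y\<close> by
  \<open>16 * M^2 * a * b * (y - b)\<close>; parity supplies the remaining factor 2.\<close>

lemma face_action_add: "[face_action M a (face_action M b y) = face_action M (a + b) y] (mod 32 * M)"
proof (cases "even y")
  case True
  then obtain z where y: "y = 2 * z" by blast
  show ?thesis
    by (rule cong_by_diff[where k = "a * b * M * z"]) (simp add: face_action_def y algebra_simps)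
next
  case False
  then obtain z where y: "y = 2 * z + 1" by (elim oddE)
  show ?thesis
  \<comment> \<open>As \<open>y\<close> is odd, one of \<open>b\<close> and \<open>y - b\<close> is
    even.\<close>
  proof (cases "even b")
    case True
    then obtain c where b: "b = 2 * c" by blast
    show ?thesis
      by (rule cong_by_diff[where k = "M * a * c * (y - b)"])
        (simp add: face_action_def y b algebra_simps)
  next
    case False
    then obtain c where b: "b = 2 * c + 1" by (elim oddE)
    show ?thesis
      by (rule cong_by_diff[where k = "M * a * b * (z - c)"])
        (simp add: face_action_def y b algebra_simps)
  qed
qed

text \<open>For \<open>M = 2^(\<alpha> - 5)\<close> these are the parameters of the first factor. An
  odd translation switches between the branches of \<open>face_action\<close>, which is why the
  mixed relations are checked on even and odd residues separately. Each \<open>k\<close> is the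
  quotient of the difference by \<open>32 * M\<close>.\<close>

lemma Gamma_model_faces:
  "Gamma_model (16 * M) (32 * M) (-1 + 8 * M) (-3 + 8 * M) (1 + 8 * M) (3 + 8 * M) (32 * M)
    (face_action M) (\<lambda>n y. y + n)"
proof
  show "[face_action M k x = face_action M k y] (mod 32 * M)" if xy: "[x = y] (mod 32 * M)" for k x y
  proof -
    obtain l where x: "x = y + 32 * M * l"
      using cong_sym[OF xy] by (auto simp: cong_iff_lin)
    show ?thesis
    proof (cases "even y")
      case True
      then show ?thesis
        by (intro cong_by_diff[where k = "l * (1 - 4 * k * M)"])
          (simp add: face_action_def x algebra_simps)
    next
      case False
      then show ?thesis
        by (intro cong_by_diff[where k = "l * (1 + 4 * M * k)"])
          (simp add: face_action_def x algebra_simps)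
    qed
  qed
  show "[face_action M a (face_action M b x) = face_action M (a + b) x] (mod 32 * M)" for a b x
    by (rule face_action_add)
  show "[face_action M (16 * M) y = y] (mod 32 * M)" for y
  proof (cases "even y")
    case True
    then show ?thesis
      by (intro cong_by_diff[where k = "- 2 * M * y"]) (simp add: face_action_def algebra_simps)
  next
    case False
    then show ?thesis
      by (intro cong_by_diff[where k = "- 1 + 2 * M * (y - 16 * M)"])
        (simp add: face_action_def algebra_simps)
  qed
  show "[face_action M 1 (face_action M 1 (y + 1) + 1) = y] (mod 32 * M)" for y
  proof (cases "even y")
    case True
    then obtain z where y: "y = 2 * z" by blast
    show ?thesis
      by (rule cong_by_diff[where k = "- M * z"]) (simp add: face_action_def y algebra_simps)
  next
    case False
    then obtain z where y: "y = 2 * z + 1" by (elim oddE)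
    show ?thesis
      by (rule cong_by_diff[where k = "- M * (z + 1)"]) (simp add: face_action_def y algebra_simps)
  qed
  show "[face_action M 1 y + - 1 = face_action M (- 1 + 8 * M) (y + (- 3 + 8 * M))] (mod 32 * M)" for y
  proof (cases "even y")
    case True
    then show ?thesis
      by (intro cong_by_diff[where k = "- M * (y - 2)"]) (simp add: face_action_def algebra_simps)
  next
    case False
    then show ?thesis
      by (intro cong_by_diff[where k = "M * (y - 4 + 8 * M)"])
        (simp add: face_action_def algebra_simps)
  qed
  show "[face_action M (- 1) y + 1 = face_action M (1 + 8 * M) (y + (3 + 8 * M))] (mod 32 * M)" for y
  proof (cases "even y")
    case True
    then show ?thesis
      by (intro cong_by_diff[where k = "- M * (y + 2)"]) (simp add: face_action_def algebra_simps)
  next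
    case False
    then show ?thesis
      by (intro cong_by_diff[where k = "M * (y + 4 + 8 * M)"])
        (simp add: face_action_def algebra_simps)
  qed
  show "[x + k = y + k] (mod 32 * M)" if xy: "[x = y] (mod 32 * M)" for k x y
    using xy by (simp add: cong_add)
  show "[x + b + a = x + (a + b)] (mod 32 * M)" for a b x by (simp add: ac_simps)
  show "[x + 32 * M = x] (mod 32 * M)" for x by (simp add: cong_def)
qed (simp_all add: face_action_def)

text \<open>The action of \<open>\<sigma>\<^sub>2\<^sup>n\<close> on the cosets \<open>\<sigma>\<^sub>1\<^sup>x \<langle>\<sigma>\<^sub>2\<rangle>\<close> in \<open>\<Gamma>\<^sub>2\<close>.\<close>

definition vertex_action :: "int \<Rightarrow> int \<Rightarrow> int \<Rightarrow> int" where
  "vertex_action M n x = (if even n then x + 4 * n * M * x else - x + 4 * M * x * (x - n))"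

lemma vertex_action_0: "vertex_action M n 0 = 0"
  by (simp add: vertex_action_def)

lemma vertex_action_add:
  "[vertex_action M a (vertex_action M b x) = vertex_action M (a + b) x] (mod 32 * M)"
proof (cases "even b")
  case True
  then obtain c where b: "b = 2 * c" by blast
  show ?thesis
  proof (cases "even a")
    case True
    then show ?thesis
      by (intro cong_by_diff[where k = "a * c * M * x"])
        (simp add: vertex_action_def b algebra_simps)
  next
    case False
    then show ?thesis
      by (intro cong_by_diff[where k = "c * M * x * (x + 4 * b * M * x + x - a)"])
        (simp add: vertex_action_def b algebra_simps)
  qed
next
  case b_odd: False
  show ?thesis
  proof (cases "even a")
    case True
    then obtain d where a: "a = 2 * d" by blast
    show ?thesis
      by (rule cong_by_diff[where k = "d * M * x * (x - b)"])
        (use b_odd in \<open>simp add: vertex_action_def a algebra_simps\<close>)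
  next
    case False
    \<comment> \<open>For odd \<open>b\<close> this product is even, so the correction in the inner
      image is \<open>8 * M * v\<close>. In the outer step the term
      \<open>4 * M * x * (x - b)\<close> cancels that correction, and all that is left has the
      factor \<open>4 * M * 8 * M\<close>.\<close>
    have "even (x * (x - b))" using b_odd by simp
    then obtain v where v: "x * (x - b) = 2 * v" by blast
    have inner: "vertex_action M b x = - x + 8 * M * v"
      using b_odd v by (simp add: vertex_action_def mult.assoc)
    have "even (a + b)" using False b_odd by simp
    have "- (- x + 8 * M * v) + 4 * M * (- x + 8 * M * v) * (- x + 8 * M * v - a) - (x + 4 * (a + b) * M * x)
      = 4 * M * (x * (x - b)) - 8 * M * v + 32 * M * (M * v * (- 2 * x - a + 8 * M * v))"
      by (simp add: algebra_simps)
    also have "\<dots> = 32 * M * (M * v * (- 2 * x - a + 8 * M * v))" by (simp add: v)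
    finally show ?thesis
      using False \<open>even (a + b)\<close> unfolding inner
      by (intro cong_by_diff[where k = "M * v * (- 2 * x - a + 8 * M * v)"]) (simp add: vertex_action_def)
  qed
qed

text \<open>The parameters of the second factor, with the roles of the generators exchanged: now the
  first one translates and the second one fixes 0. The two mixed relations hold exactly in the
  integers, hence \<open>k = 0\<close> there.\<close>

lemma Gamma_model_vertices:
  "Gamma_model (32 * M) 8 (-1 + 8 * M) (-3) (1 + 8 * M) 3 (32 * M) (\<lambda>n y. y + n) (vertex_action M)"
proof
  show "[vertex_action M k x = vertex_action M k y] (mod 32 * M)" if xy: "[x = y] (mod 32 * M)" for k x y
  proof -
    obtain l where x: "x = y + 32 * M * l"
      using cong_sym[OF xy] by (auto simp: cong_iff_lin)
    show ?thesis
    proof (cases "even k")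
      case True
      then show ?thesis
        by (intro cong_by_diff[where k = "l * (1 + 4 * k * M)"])
          (simp add: vertex_action_def x algebra_simps)
    next
      case False
      then show ?thesis
        by (intro cong_by_diff[where k = "- l + 4 * M * l * (x + y - k)"])
          (simp add: vertex_action_def x algebra_simps)
    qed
  qed
  show "[vertex_action M a (vertex_action M b x) = vertex_action M (a + b) x] (mod 32 * M)" for a b x
    by (rule vertex_action_add)
  show "[vertex_action M 8 x = x] (mod 32 * M)" for x
    by (rule cong_by_diff[where k = x]) (simp add: vertex_action_def)
  show "[vertex_action M 1 (vertex_action M 1 x + 1) + 1 = x] (mod 32 * M)" for x
  proof -
    have "even (x * (x - 1))" by simp
    then obtain v where v: "x * (x - 1) = 2 * v" by blast
    have inner: "vertex_action M 1 x = - x + 8 * M * v"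
      using v by (simp add: vertex_action_def mult.assoc)
    have "- (- x + 8 * M * v + 1) + 4 * M * (- x + 8 * M * v + 1) * (- x + 8 * M * v + 1 - 1) + 1 - x
      = 4 * M * (x * (x - 1)) - 8 * M * v + 32 * M * (M * v * (1 - 2 * x + 8 * M * v))"
      by (simp add: algebra_simps)
    also have "\<dots> = 32 * M * (M * v * (1 - 2 * x + 8 * M * v))" by (simp add: v)
    finally show ?thesis
      unfolding inner
      by (intro cong_by_diff[where k = "M * v * (1 - 2 * x + 8 * M * v)"]) (simp add: vertex_action_def)
  qed
  show "[vertex_action M (- 1) (x + 1) = vertex_action M (- 3) x + (- 1 + 8 * M)] (mod 32 * M)" for x
    by (rule cong_by_diff[where k = 0]) (simp add: vertex_action_def algebra_simps)
  show "[vertex_action M 1 (x + - 1) = vertex_action M 3 x + (1 + 8 * M)] (mod 32 * M)" for x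
    by (rule cong_by_diff[where k = 0]) (simp add: vertex_action_def algebra_simps)
  show "[x + k = y + k] (mod 32 * M)" if xy: "[x = y] (mod 32 * M)" for k x y
    using xy by (simp add: cong_add)
  show "[x + b + a = x + (a + b)] (mod 32 * M)" for a b x by (simp add: ac_simps)
  show "[x + 32 * M = x] (mod 32 * M)" for x by (simp add: cong_def)
qed (simp_all add: vertex_action_def)

section \<open>Factorisation into powers of the two generators\<close>

locale rotation_pair = group G for G :: "'a monoid" (structure) +
  fixes s t :: 'a
  assumes s_closed: "s \<in> carrier G" and t_closed: "t \<in> carrier G"
    and st_involution: "(s \<otimes> t) \<otimes> (s \<otimes> t) = \<one>"
begin

abbreviation C where "C \<equiv> carrier G"

text \<open>With left multiplications a product becomes a composition, in which neighbouring powers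
  of one generator merge and a relation can be applied in front of any element.\<close>

definition Sp :: "int \<Rightarrow> 'a \<Rightarrow> 'a" where "Sp i x = s [^] i \<otimes> x"
definition Tp :: "int \<Rightarrow> 'a \<Rightarrow> 'a" where "Tp j x = t [^] j \<otimes> x"

lemma Sp_closed [simp]: "x \<in> C \<Longrightarrow> Sp i x \<in> C"
  and Tp_closed [simp]: "x \<in> C \<Longrightarrow> Tp i x \<in> C"
  by (simp_all add: Sp_def Tp_def s_closed t_closed)

lemma Sp_Sp [simp]: "x \<in> C \<Longrightarrow> Sp i (Sp j x) = Sp (i + j) x"
  and Tp_Tp [simp]: "x \<in> C \<Longrightarrow> Tp i (Tp j x) = Tp (i + j) x"
  by (simp_all add: Sp_def Tp_def s_closed t_closed int_pow_mult m_assoc)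

lemma Sp_0 [simp]: "x \<in> C \<Longrightarrow> Sp 0 x = x" and Tp_0 [simp]: "x \<in> C \<Longrightarrow> Tp 0 x = x"
  by (simp_all add: Sp_def Tp_def)

lemma Sp_mult: "x \<in> C \<Longrightarrow> g \<in> C \<Longrightarrow> Sp i x \<otimes> g = Sp i (x \<otimes> g)"
  and Tp_mult: "x \<in> C \<Longrightarrow> g \<in> C \<Longrightarrow> Tp i x \<otimes> g = Tp i (x \<otimes> g)"
  by (simp_all add: Sp_def Tp_def s_closed t_closed m_assoc)

lemma ST: "x \<in> C \<Longrightarrow> Sp 1 (Tp 1 x) = Tp (-1) (Sp (-1) x)"
proof -
  assume x: "x \<in> C"
  have "s \<otimes> t = inv (s \<otimes> t)"
    using st_involution s_closed t_closed by (metis inv_equality m_closed)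
  then have "s \<otimes> t = inv t \<otimes> inv s" using s_closed t_closed by (simp add: inv_mult_group)
  then show ?thesis
    using x s_closed t_closed by (simp add: Sp_def Tp_def m_assoc[symmetric] int_pow_neg)
qed

lemma TS: "x \<in> C \<Longrightarrow> Tp 1 (Sp 1 x) = Sp (-1) (Tp (-1) x)"
  using ST[of "Tp (-1) x"] by simp

end

section \<open>The relations with parameter \<open>N\<close>, and commutation of \<open>s^N\<close>
  with even powers of \<open>t\<close>\<close>

locale twisted_rotation_pair = rotation_pair +
  fixes N M :: int
  assumes rel1: "inv t \<otimes> s = s [^] (-1 + N) \<otimes> t [^] (-3 + N)"
    and rel2: "t \<otimes> inv s = s [^] (1 + N) \<otimes> t [^] (3 + N)"
    and t_exponent: "t [^] M = \<one>" and coprime_3: "coprime 3 M"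
    and N_even: "even N"
begin

lemma Tp_neg_Sp: "x \<in> C \<Longrightarrow> Tp (-1) (Sp 1 x) = Sp (-1 + N) (Tp (-3 + N) x)"
  using arg_cong[OF rel1, of "\<lambda>y. y \<otimes> x"] s_closed t_closed
  by (simp add: Sp_def Tp_def int_pow_neg m_assoc)

lemma Tp_Sp_neg: "x \<in> C \<Longrightarrow> Tp 1 (Sp (-1) x) = Sp (1 + N) (Tp (3 + N) x)"
  using arg_cong[OF rel2, of "\<lambda>y. y \<otimes> x"] s_closed t_closed
  by (simp add: Sp_def Tp_def int_pow_neg m_assoc)

text \<open>Write \<open>t^2 s = t (t s) = t s^-1 t^-1\<close> and apply the second
  relation.\<close>

lemma Tp_2_Sp: "x \<in> C \<Longrightarrow> Tp 2 (Sp 1 x) = Sp (1 + N) (Tp (2 + N) x)"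
  using arg_cong[OF TS[of x], of "Tp 1"] Tp_Sp_neg[of "Tp (-1) x"] by simp

lemma Tp_neg_2_Sp_neg: "x \<in> C \<Longrightarrow> Tp (-2) (Sp (-1) x) = Sp (-1 + N) (Tp (-2 + N) x)"
  using arg_cong[OF ST[of x], of "Tp (-1)"] Tp_neg_Sp[of "Tp 1 x"] by simp

text \<open>Solving \<open>Tp_2_Sp\<close> for \<open>s^N\<close> gives an expression in which
  \<open>s\<close> occurs only with the exponents 1 and -1.\<close>

lemma Sp_N: "x \<in> C \<Longrightarrow> Sp N x = Sp (-1) (Tp 2 (Sp 1 (Tp (-2 - N) x)))"
  using Tp_2_Sp[of "Tp (-2 - N) x"] by simp

lemma Sp_neg_N:
  assumes "x \<in> C"
  shows "Sp 1 (Tp 2 (Sp (-1) x)) = Tp (2 - N) (Sp (-N) x)"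
proof -
  \<comment> \<open>Chosen so that \<open>Tp_neg_2_Sp_neg\<close> collapses
    \<open>t^-2 s^-1 y\<close> to \<open>s^-1 x\<close>.\<close>
  define y where "y = Tp (2 - N) (Sp (-N) x)"
  have y: "y \<in> C" using assms by (simp add: y_def)
  have "Tp (-2) (Sp (-1) y) = Sp (-1) x"
    using Tp_neg_2_Sp_neg[OF y] assms by (simp add: y_def)
  then have "Tp 2 (Sp (-1) x) = Sp (-1) y" using y assms by (metis Sp_closed Tp_0 Tp_Tp add.right_inverse)
  then show ?thesis using y by (simp add: y_def[symmetric])
qed

text \<open>In \<open>t s^-1 t^2 s t^(-2-N)\<close> substitute \<open>s^-1 = t s t\<close>. Then
  \<open>t^3 s = t^2 s^-1 t^-1\<close> leaves the conjugate \<open>s t^2 s^-1\<close>, which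
  \<open>Sp_neg_N\<close> evaluates.\<close>

lemma Tp_Sp_N:
  assumes x: "x \<in> C"
  shows "Tp 1 (Sp N x) = Tp (4 - N) (Sp (-N) (Tp (-3 - N) x))"
proof -
  define w where "w = Tp (-2 - N) x"
  have w: "w \<in> C" using x by (simp add: w_def)
  have *: "Sp (-1) v = Tp 1 (Sp 1 (Tp 1 v))" if "v \<in> C" for v
    using TS[of "Tp 1 v"] that by simp
  have "Tp 1 (Sp N x) = Tp 2 (Sp 1 (Tp 3 (Sp 1 w)))"
    using Sp_N[OF x] *[of "Tp 2 (Sp 1 w)"] w by (simp add: w_def)
  also have "Tp 3 (Sp 1 w) = Tp 2 (Sp (-1) (Tp (-1) w))"
    using arg_cong[OF TS[OF w], of "Tp 2"] w by simp
  also have "Tp 2 (Sp 1 \<dots>) = Tp 2 (Tp (2 - N) (Sp (-N) (Tp (-1) w)))"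
    using Sp_neg_N[of "Tp (-1) w"] w by simp
  finally show ?thesis using x by (simp add: w_def)
qed

lemma Tp_Sp_neg_N:
  assumes x: "x \<in> C"
  shows "Tp 1 (Sp (-N) x) = Tp (4 + N) (Sp N (Tp (-3 + N) x))"
proof -
  \<comment> \<open>At this argument the \<open>s^(-N)\<close> produced by \<open>Tp_Sp_N\<close>
    meets an \<open>s^N\<close>, and everything cancels except one \<open>t\<close>. The argument is
    therefore \<open>s^(-N) x\<close>.\<close>
  have "Tp 1 (Sp N (Tp (3 + N) (Sp N (Tp (-3 + N) x)))) = Tp 1 x"
    using Tp_Sp_N[of "Tp (3 + N) (Sp N (Tp (-3 + N) x))"] x by simp
  then have "Tp (-1) (Tp 1 (Sp N (Tp (3 + N) (Sp N (Tp (-3 + N) x))))) = Tp (-1) (Tp 1 x)" by simp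
  then have "Sp N (Tp (3 + N) (Sp N (Tp (-3 + N) x))) = x" using x by simp
  then have "Sp (-N) (Sp N (Tp (3 + N) (Sp N (Tp (-3 + N) x)))) = Sp (-N) x" by simp
  then have "Tp (3 + N) (Sp N (Tp (-3 + N) x)) = Sp (-N) x" using x by simp
  then have "Tp 1 (Tp (3 + N) (Sp N (Tp (-3 + N) x))) = Tp 1 (Sp (-N) x)" by simp
  then show ?thesis using x by simp
qed

text \<open>\<open>Tp_Sp_N\<close> changes \<open>s^N\<close> into \<open>s^(-N)\<close> and
  \<open>Tp_Sp_neg_N\<close> changes it back. In front of \<open>t^6\<close> the powers of
  \<open>t\<close> that contain \<open>N\<close> cancel, which leaves
  \<open>t^2 s^N t^6 = t^8 s^N\<close>.\<close>

lemma Tp_6_Sp_N: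
  assumes x: "x \<in> C"
  shows "Tp 6 (Sp N x) = Sp N (Tp 6 x)"
proof -
  have "Tp 2 (Sp N (Tp 6 x)) = Tp 1 (Tp 1 (Sp N (Tp 6 x)))" using x by simp
  also have "\<dots> = Tp (4 - N) (Tp 1 (Sp (-N) (Tp (3 - N) x)))"
    using Tp_Sp_N[of "Tp 6 x"] x by (simp add: add.commute)
  also have "\<dots> = Tp 2 (Tp 6 (Sp N x))"
    using Tp_Sp_neg_N[of "Tp (3 - N) x"] x by simp
  finally have "Tp (-2) (Tp 2 (Sp N (Tp 6 x))) = Tp (-2) (Tp 2 (Tp 6 (Sp N x)))" by simp
  then show ?thesis using x by simp
qed

text \<open>Stated for an arbitrary integer action \<open>f\<close> because it serves first for
  powers of \<open>t^6\<close> and then for powers of \<open>s^N\<close>.\<close>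

lemma int_multiple_commute:
  fixes f :: "int \<Rightarrow> 'a \<Rightarrow> 'a"
  assumes f: "\<And>x i j. x \<in> C \<Longrightarrow> f i (f j x) = f (i + j) x"
    "\<And>x. x \<in> C \<Longrightarrow> f 0 x = x" "\<And>x i. x \<in> C \<Longrightarrow> f i x \<in> C"
    and h: "\<And>x. x \<in> C \<Longrightarrow> h x \<in> C" and comm: "\<And>x. x \<in> C \<Longrightarrow> f d (h x) = h (f d x)"
    and x: "x \<in> C"
  shows "f (k * d) (h x) = h (f (k * d) x)"
  using x
proof (induction k arbitrary: x rule: int_induct[of _ 0])
  case base
  then show ?case using f h by simp
next
  case (step1 i)
  have "f ((i + 1) * d) (h x) = f (i * d) (f d (h x))" using step1 f h by (simp add: algebra_simps)
  also have "\<dots> = h (f (i * d) (f d x))" using step1 comm f by simp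
  finally show ?case using step1 f by (simp add: algebra_simps)
next
  case (step2 i)
  have "f d (h (f (- d) x)) = h x" using comm[of "f (-d) x"] f step2 by simp
  then have "f (- d) (h x) = f (- d) (f d (h (f (- d) x)))" by simp
  then have "f (- d) (h x) = h (f (- d) x)" using f h step2 by simp
  moreover have "f ((i - 1) * d) (h x) = f (i * d) (f (- d) (h x))"
    using step2 f h by (simp add: algebra_simps)
  ultimately have "f ((i - 1) * d) (h x) = h (f (i * d) (f (- d) x))" using step2 f by simp
  then show ?case using step2 f by (simp add: algebra_simps)
qed

text \<open>Since 3 is invertible modulo \<open>M\<close>, \<open>t\<^sup>2\<close> is a power of \<open>t\<^sup>6\<close>.\<close>

lemma Tp_even_Sp_N:
  assumes x: "x \<in> C" and "even j"
  shows "Tp j (Sp (k * N) x) = Sp (k * N) (Tp j x)"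
proof -
  obtain a b :: int where ab: "a * 3 + b * M = 1"
    using coprime_3 by (metis bezout_int coprime_imp_gcd_eq_1)
  obtain c where c: "j = 2 * c" using \<open>even j\<close> by auto
  have "j = (c * a) * 6 + M * (b * j)" using arg_cong[OF ab, of "\<lambda>z. j * z"] c by (simp add: algebra_simps)
  moreover have "Tp (M * l) y = y" if "y \<in> C" for y l
    using that t_exponent t_closed by (simp add: Tp_def int_pow_pow[symmetric])
  ultimately have Tp_j: "Tp j y = Tp ((c * a) * 6) y" if "y \<in> C" for y
    using that by (metis Tp_Tp)
  have "Tp j (Sp N y) = Sp N (Tp j y)" if "y \<in> C" for y
    using int_multiple_commute[where f = Tp and d = 6 and h = "Sp N" and x = y and k = "c * a"] that Tp_6_Sp_N Tp_j by simp
  then show ?thesis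
    using int_multiple_commute[where f = Sp and d = N and h = "Tp j" and x = x and k = k] x by simp
qed

section \<open>Moving powers of \<open>t\<close> to the right of powers of \<open>s\<close>\<close>

lemma Tp_even_Sp:
  assumes "x \<in> C"
  shows "Tp (2 * k) (Sp 1 x) = Sp (1 + k * N) (Tp (k * (2 + N)) x)"
proof -
  \<comment> \<open>In front of \<open>s\<close>, \<open>t^2\<close> turns into
    \<open>t^(2+N)\<close>; since \<open>N\<close> is even, this power commutes with the remaining
    \<open>s^(k N)\<close>.\<close>
  have step: "Tp 2 (Sp (1 + k * N) y) = Sp (1 + (k + 1) * N) (Tp (2 + N) y)" if "y \<in> C" for y k
    using that Tp_2_Sp[of "Sp (k * N) y"] Tp_even_Sp_N[of y "2 + N" k] N_even
    by (simp add: algebra_simps)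
  show ?thesis
    using assms
  proof (induction k arbitrary: x rule: int_induct[of _ 0])
    case (step1 k)
    have "Tp (2 * (k + 1)) (Sp 1 x) = Tp 2 (Tp (2 * k) (Sp 1 x))"
      using step1(3) by (simp add: algebra_simps)
    also have "\<dots> = Tp 2 (Sp (1 + k * N) (Tp (k * (2 + N)) x))"
      using step1(2)[OF step1(3)] by simp
    finally show ?case using step1(3) step[of "Tp (k * (2 + N)) x" k] by (simp add: algebra_simps)
  next
    case (step2 k)
    have "Tp (2 * (k - 1)) (Sp 1 x) = Tp (-2) (Tp (2 * k) (Sp 1 x))"
      using step2(3) by (simp add: algebra_simps)
    \<comment> \<open>Going down, \<open>step\<close> for \<open>k - 1\<close> is read from right to
      left to expose a factor \<open>t^2\<close>.\<close>
    also have "\<dots> = Tp (-2) (Tp 2 (Sp (1 + (k - 1) * N) (Tp (- (2 + N)) (Tp (k * (2 + N)) x))))"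
      using step2 step[of "Tp (- (2 + N)) (Tp (k * (2 + N)) x)" "k - 1"] by simp
    also have "\<dots> = Sp (1 + (k - 1) * N) (Tp ((k - 1) * (2 + N)) x)"
      using step2(3) by (simp add: algebra_simps)
    finally show ?case .
  qed simp
qed

text \<open>The basic relation is now the one for \<open>t^-2 s^-1\<close>, so the downward step is
  direct and the upward step reads it backwards.\<close>

lemma Tp_even_Sp_neg:
  assumes "x \<in> C"
  shows "Tp (2 * k) (Sp (-1) x) = Sp (-1 - k * N) (Tp (k * (2 - N)) x)"
proof -
  have step: "Tp (-2) (Sp (-1 - k * N) y) = Sp (-1 - (k - 1) * N) (Tp (-2 + N) y)" if "y \<in> C" for y k
    using that Tp_neg_2_Sp_neg[of "Sp (- k * N) y"] Tp_even_Sp_N[of y "-2 + N" "-k"] N_even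
    by (simp add: algebra_simps)
  show ?thesis
    using assms
  proof (induction k arbitrary: x rule: int_induct[of _ 0])
    case (step2 k)
    have "Tp (2 * (k - 1)) (Sp (-1) x) = Tp (-2) (Tp (2 * k) (Sp (-1) x))"
      using step2(3) by (simp add: algebra_simps)
    also have "\<dots> = Tp (-2) (Sp (-1 - k * N) (Tp (k * (2 - N)) x))"
      using step2(2)[OF step2(3)] by simp
    finally show ?case using step2(3) step[of "Tp (k * (2 - N)) x" k] by (simp add: algebra_simps)
  next
    case (step1 k)
    have "Tp (2 * (k + 1)) (Sp (-1) x) = Tp 2 (Tp (2 * k) (Sp (-1) x))"
      using step1(3) by (simp add: algebra_simps)
    also have "\<dots> = Tp 2 (Tp (-2) (Sp (-1 - (k + 1) * N) (Tp (2 - N) (Tp (k * (2 - N)) x))))"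
      using step1 step[of "Tp (2 - N) (Tp (k * (2 - N)) x)" "k + 1"] by simp
    also have "\<dots> = Sp (-1 - (k + 1) * N) (Tp ((k + 1) * (2 - N)) x)"
      using step1(3) by (simp add: algebra_simps)
    finally show ?case .
  qed simp
qed

text \<open>Odd powers of \<open>t\<close> reduce to even ones by \<open>t s = s^-1 t^-1\<close> and
  \<open>s^-1 = t s t\<close>. The exponents are chosen before \<open>x\<close>, so that the
  rewriting can be iterated over the letters of \<open>s^i\<close>.\<close>

lemma Tp_Sp_unit_factors:
  assumes "e = 1 \<or> e = -1"
  shows "\<exists>a b. \<forall>x\<in>C. Tp j (Sp e x) = Sp a (Tp b x)"
proof (cases "even j")
  case True
  then obtain k where "j = 2 * k" by blast
  then show ?thesis using assms Tp_even_Sp[of _ k] Tp_even_Sp_neg[of _ k] by blast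
next
  case False
  then obtain k where k: "j = 2 * k + 1" by (elim oddE)
  have "\<forall>x\<in>C. Tp j (Sp 1 x) = Sp (-1 - k * N) (Tp (k * (2 - N) - 1) x)"
  proof
    fix x assume x: "x \<in> C"
    have "Tp j (Sp 1 x) = Tp (2 * k) (Tp 1 (Sp 1 x))" using x k by simp
    also have "\<dots> = Tp (2 * k) (Sp (-1) (Tp (-1) x))" using TS x by simp
    finally show "Tp j (Sp 1 x) = Sp (-1 - k * N) (Tp (k * (2 - N) - 1) x)"
      using x Tp_even_Sp_neg[of "Tp (-1) x" k] by simp
  qed
  moreover have "\<forall>x\<in>C. Tp j (Sp (-1) x) = Sp (1 + (k + 1) * N) (Tp ((k + 1) * (2 + N) + 1) x)"
  proof
    fix x assume x: "x \<in> C"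
    have "Tp j (Sp (-1) x) = Tp j (Tp 1 (Sp 1 (Tp 1 x)))" using TS[of "Tp 1 x"] x by simp
    also have "\<dots> = Tp (2 * (k + 1)) (Sp 1 (Tp 1 x))" using x k by (simp add: algebra_simps)
    finally show "Tp j (Sp (-1) x) = Sp (1 + (k + 1) * N) (Tp ((k + 1) * (2 + N) + 1) x)"
      using x Tp_even_Sp[of "Tp 1 x" "k + 1"] by simp
  qed
  ultimately show ?thesis using assms by blast
qed

lemma Tp_Sp_factors: "\<exists>a b. \<forall>x\<in>C. Tp j (Sp i x) = Sp a (Tp b x)"
proof (induction i rule: int_induct[of _ 0])
  case base
  have "\<forall>x\<in>C. Tp j (Sp 0 x) = Sp 0 (Tp j x)" by simp
  then show ?case by blast
next
  case (step1 i)
  then obtain a b where ab: "\<forall>x\<in>C. Tp j (Sp i x) = Sp a (Tp b x)" by blast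
  obtain a' b' where ab': "\<forall>x\<in>C. Tp b (Sp 1 x) = Sp a' (Tp b' x)" using Tp_Sp_unit_factors by blast
  have "\<forall>x\<in>C. Tp j (Sp (i + 1) x) = Sp (a + a') (Tp b' x)"
  proof
    fix x assume x: "x \<in> C"
    have "Tp j (Sp (i + 1) x) = Tp j (Sp i (Sp 1 x))" using x by simp
    also have "\<dots> = Sp a (Tp b (Sp 1 x))" using ab x by (simp del: Sp_Sp)
    finally show "Tp j (Sp (i + 1) x) = Sp (a + a') (Tp b' x)" using ab' x by simp
  qed
  then show ?case by blast
next
  case (step2 i)
  then obtain a b where ab: "\<forall>x\<in>C. Tp j (Sp i x) = Sp a (Tp b x)" by blast
  obtain a' b' where ab': "\<forall>x\<in>C. Tp b (Sp (-1) x) = Sp a' (Tp b' x)" using Tp_Sp_unit_factors by blast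
  have "\<forall>x\<in>C. Tp j (Sp (i - 1) x) = Sp (a + a') (Tp b' x)"
  proof
    fix x assume x: "x \<in> C"
    have "Tp j (Sp (i - 1) x) = Tp j (Sp i (Sp (-1) x))" using x by simp
    also have "\<dots> = Sp a (Tp b (Sp (-1) x))" using ab x by (simp del: Sp_Sp)
    finally show "Tp j (Sp (i - 1) x) = Sp (a + a') (Tp b' x)" using ab' x by simp
  qed
  then show ?case by blast
qed

text \<open>Elements of this form are closed under products because the inner \<open>t^j s^k\<close>
  of \<open>s^i t^j s^k t^l\<close> can be turned around.\<close>

lemma generate_factors:
  assumes "x \<in> generate G {s, t}"
  shows "\<exists>(i::int) (j::int). x = s [^] i \<otimes> t [^] j"
proof -
  have "\<exists>i j. x = Sp i (Tp j \<one>)"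
    using assms
  proof (induction rule: generate.induct)
    case one
    have "\<one> = Sp 0 (Tp 0 \<one>)" by simp
    then show ?case by blast
  next
    case (incl h)
    then have "h = Sp 1 (Tp 0 \<one>) \<or> h = Sp 0 (Tp 1 \<one>)"
      using s_closed t_closed by (auto simp: Sp_def Tp_def)
    then show ?case by blast
  next
    case (inv h)
    then have "inv h = Sp (-1) (Tp 0 \<one>) \<or> inv h = Sp 0 (Tp (-1) \<one>)"
      using s_closed t_closed by (auto simp: Sp_def Tp_def int_pow_neg)
    then show ?case by blast
  next
    case (eng h1 h2)
    then obtain i j k l where h: "h1 = Sp i (Tp j \<one>)" "h2 = Sp k (Tp l \<one>)" by blast
    obtain a b where "\<forall>x\<in>C. Tp j (Sp k x) = Sp a (Tp b x)" using Tp_Sp_factors by blast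
    then have "h1 \<otimes> h2 = Sp (i + a) (Tp (b + l) \<one>)" unfolding h by (simp add: Sp_mult Tp_mult)
    then show ?case by blast
  qed
  then show ?thesis using s_closed t_closed by (auto simp: Sp_def Tp_def)
qed

end

section \<open>The coset polyhedron\<close>

lemma card_2_unique_other:
  assumes "card A = 2" "a \<in> A" "x \<in> A" "y \<in> A" "x \<noteq> a" "y \<noteq> a"
  shows "x = y"
  using assms by (auto simp: card_2_iff)

text \<open>Each of the three axioms with the value 2 leaves exactly one alternative for one element
  of a flag when the other two are kept. This makes the definite description in
  \<open>adj_flag\<close> meaningful.\<close>

lemma adj_flag_eqI:
  assumes K: "polyhedron K" and \<Phi>: "\<Phi> \<in> flags K" and \<Psi>: "\<Psi> \<in> flags K" and i: "i \<in> {0, 1, 2}"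
    and adj: "\<forall>j\<in>{0, 1, 2}. flag_elem \<Psi> j \<noteq> flag_elem \<Phi> j \<longleftrightarrow> j = i"
  shows "adj_flag K i \<Phi> = \<Psi>"
  unfolding adj_flag_def
proof (rule the_equality)
  show "\<Psi> \<in> flags K \<and> (\<forall>j\<in>{0, 1, 2}. flag_elem \<Psi> j \<noteq> flag_elem \<Phi> j \<longleftrightarrow> j = i)"
    using \<Psi> adj by blast
next
  fix X assume X: "X \<in> flags K \<and> (\<forall>j\<in>{0, 1, 2}. flag_elem X j \<noteq> flag_elem \<Phi> j \<longleftrightarrow> j = i)"
  obtain v e f v' e' f' v'' e'' f'' where
    eqs: "\<Phi> = (v, e, f)" "\<Psi> = (v', e', f')" "X = (v'', e'', f'')"
    by (metis prod.exhaust)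
  consider "i = 0" | "i = 1" | "i = 2" using i by auto
  then show "X = \<Psi>"
  proof cases
    case 1
    then have h: "v' \<noteq> v" "v'' \<noteq> v" "e' = e" "e'' = e" "f' = f" "f'' = f"
      using adj X eqs by auto
    have "v' = v''"
      by (rule card_2_unique_other[of "{v \<in> of_rank K 0. incident K v e}" v])
        (use h \<Phi> \<Psi> X K eqs in \<open>auto simp: flags_def polyhedron_def\<close>)
    then show ?thesis using h eqs by simp
  next
    case 2
    then have h: "e' \<noteq> e" "e'' \<noteq> e" "v' = v" "v'' = v" "f' = f" "f'' = f"
      using adj X eqs by auto
    have "e' = e''"
      by (rule card_2_unique_other[of "{e \<in> of_rank K 1. incident K v e \<and> incident K e f}" e])
        (use h \<Phi> \<Psi> X K eqs in \<open>auto simp: flags_def polyhedron_def\<close>)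
    then show ?thesis using h eqs by simp
  next
    case 3
    then have h: "f' \<noteq> f" "f'' \<noteq> f" "v' = v" "v'' = v" "e' = e" "e'' = e"
      using adj X eqs by auto
    have "f' = f''"
      by (rule card_2_unique_other[of "{f \<in> of_rank K 2. incident K e f}" f])
        (use h \<Phi> \<Psi> X K eqs in \<open>auto simp: flags_def polyhedron_def\<close>)
    then show ?thesis using h eqs by simp
  qed
qed

text \<open>The definition of an automorphism speaks of the order alone. The image of a flag is a
  strict chain of three elements with ranks among 0, 1, 2, so these ranks must be 0, 1, 2 in
  turn.\<close>

lemma aut_group_flag_image_in_flags:
  assumes K: "polyhedron K" and g: "g \<in> carrier (aut_group K)" and \<Phi>: "\<Phi> \<in> flags K"
  shows "flag_image g \<Phi> \<in> flags K"
proof -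
  obtain v e f where \<Phi>_eq: "\<Phi> = (v, e, f)" by (metis prod.exhaust)
  have bij: "bij_betw g (elems K) (elems K)"
    and ord: "\<And>x y. \<lbrakk>x \<in> elems K; y \<in> elems K\<rbrakk> \<Longrightarrow>
      (x, y) \<in> order_rel K \<longleftrightarrow> (g x, g y) \<in> order_rel K"
    using g by (auto simp: aut_group_def Bij_def)
  have rank_less: "\<And>x y. (x, y) \<in> order_rel K \<Longrightarrow> x \<noteq> y \<Longrightarrow> rank K x < rank K y"
    and ranks: "\<And>x. x \<in> elems K \<Longrightarrow> rank K x \<in> {0, 1, 2}"
    using K by (auto simp: polyhedron_def)
  have mem: "v \<in> elems K" "e \<in> elems K" "f \<in> elems K"
    and rk: "rank K v = 0" "rank K e = 1" "rank K f = 2"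
    and inc: "incident K v e" "incident K e f" "incident K v f"
    using \<Phi> \<Phi>_eq by (auto simp: flags_def of_rank_def)
  have ne: "v \<noteq> e" "e \<noteq> f" "v \<noteq> f" using rk by auto
  have o: "(v, e) \<in> order_rel K" "(e, f) \<in> order_rel K" "(v, f) \<in> order_rel K"
    using inc rk ne rank_less[of e v] rank_less[of f e] rank_less[of f v]
    by (auto simp: incident_def)
  have gmem: "g v \<in> elems K" "g e \<in> elems K" "g f \<in> elems K"
    using mem bij by (auto simp: bij_betw_def)
  have gne: "g v \<noteq> g e" "g e \<noteq> g f"
    using mem bij ne by (auto simp: bij_betw_def inj_on_def)
  have go: "(g v, g e) \<in> order_rel K" "(g e, g f) \<in> order_rel K" "(g v, g f) \<in> order_rel K"
    using o ord mem by auto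
  have "rank K (g v) < rank K (g e)" "rank K (g e) < rank K (g f)"
    using rank_less go gne by auto
  then have "rank K (g v) = 0" "rank K (g e) = 1" "rank K (g f) = 2"
    using ranks[OF gmem(1)] ranks[OF gmem(2)] ranks[OF gmem(3)] by auto
  then show ?thesis
    using gmem go by (simp add: flags_def of_rank_def incident_def \<Phi>_eq)
qed

lemma aut_group_adj_flag:
  assumes K: "polyhedron K" and g: "g \<in> carrier (aut_group K)"
    and \<Phi>: "\<Phi> \<in> flags K" and \<Psi>: "\<Psi> \<in> flags K" and i: "i \<in> {0, 1, 2}"
    and adj: "\<forall>j\<in>{0, 1, 2}. flag_elem \<Psi> j \<noteq> flag_elem \<Phi> j \<longleftrightarrow> j = i"
  shows "adj_flag K i (flag_image g \<Phi>) = flag_image g \<Psi>"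
proof (rule adj_flag_eqI[OF K _ _ i])
  have inj: "inj_on g (elems K)"
    using g by (auto simp: aut_group_def Bij_def bij_betw_def)
  have elem: "flag_elem X j \<in> elems K" "flag_elem (flag_image g X) j = g (flag_elem X j)"
    if "X \<in> flags K" for X j
    using that by (cases X; auto simp: flags_def of_rank_def)+
  show "\<forall>j\<in>{0, 1, 2}. flag_elem (flag_image g \<Psi>) j \<noteq> flag_elem (flag_image g \<Phi>) j \<longleftrightarrow> j = i"
    using adj elem[OF \<Phi>] elem[OF \<Psi>] inj by (auto simp: inj_on_eq_iff)
qed (use K g \<Phi> \<Psi> aut_group_flag_image_in_flags in blast)+

lemma incident_commute: "incident L x y = incident L y x" by (auto simp: incident_def)

text \<open>By periodicity and the last hypothesis, \<open>f\<close> induces an injection on the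
  residues modulo \<open>m\<close>.\<close>

lemma card_periodic_range:
  fixes f :: "int \<Rightarrow> 'b" and m :: nat
  assumes "m > 0" and "\<And>i. f (i mod int m) = f i" and "\<And>i k. f i = f k \<Longrightarrow> int m dvd i - k"
  shows "finite (range f) \<and> card (range f) = m"
proof -
  have "range f = f ` {0..<int m}"
  proof (intro equalityI subsetI)
    fix y assume "y \<in> range f"
    then obtain i where "y = f (i mod int m)" using assms(2) by auto
    then show "y \<in> f ` {0..<int m}" using assms(1) by auto
  qed auto
  moreover have "inj_on f {0..<int m}"
  proof (rule inj_onI)
    fix i k assume "i \<in> {0..<int m}" "k \<in> {0..<int m}" "f i = f k"
    then show "i = k" using assms(3)[of i k] by (metis atLeastLessThan_iff mod_eq_dvd_iff mod_pos_pos_trivial)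
  qed
  ultimately show ?thesis by (simp add: card_image)
qed

text \<open>Incidence is symmetric, so paths from one base element can be reversed and
  joined.\<close>

lemma incidence_connectedI:
  assumes "x \<in> S" "\<And>y. y \<in> S \<Longrightarrow> (x, y) \<in> {(u, v). u \<in> S \<and> v \<in> S \<and> incident L u v}\<^sup>*"
  shows "incidence_connected L S"
proof -
  let ?r = "{(u, v). u \<in> S \<and> v \<in> S \<and> incident L u v}"
  have "sym ?r" by (auto simp: sym_def incident_def)
  then have "sym (?r\<^sup>*)" by (rule sym_rtrancl)
  then show ?thesis
    unfolding incidence_connected_def using assms(2) by (meson rtrancl_trans symD)
qed

lemma int_sequence_connected:
  fixes a :: "int \<Rightarrow> 'b"
  assumes "\<And>i. (a i, a (i + 1)) \<in> r\<^sup>*" "\<And>i. (a (i + 1), a i) \<in> r\<^sup>*"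
  shows "(a 0, a i) \<in> r\<^sup>*"
proof (induction i rule: int_induct[of _ 0])
  case (step1 i)
  then show ?case using assms(1)[of i] by (meson rtrancl_trans)
next
  case (step2 i)
  then show ?case using assms(2)[of "i - 1"] by (simp add: rtrancl_trans)
qed simp

text \<open>\<open>independent\<close> contains both the trivial intersection of the two cyclic
  subgroups and, with one exponent equal to 0, the exact orders of \<open>s\<close> and
  \<open>t\<close>. Together with \<open>factorisation\<close> it makes the group an exact product
  of the two subgroups.\<close>

locale tight_rotation_group = rotation_pair +
  fixes p q :: nat
  assumes p_gt_1: "p > 1" and q_gt_1: "q > 1"
    and s_order: "s [^] int p = \<one>" and t_order: "t [^] int q = \<one>"
    and factorisation: "\<And>x. x \<in> carrier G \<Longrightarrow> \<exists>(i::int) (j::int). x = s [^] i \<otimes> t [^] j"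
    and independent: "\<And>(i::int) (j::int). s [^] i = t [^] j \<Longrightarrow> int p dvd i \<and> int q dvd j"
begin

section \<open>Exact factorisation and the order of the group\<close>

lemma Sp_dvd: "int p dvd i \<Longrightarrow> x \<in> C \<Longrightarrow> Sp i x = x"
  and Tp_dvd: "int q dvd i \<Longrightarrow> x \<in> C \<Longrightarrow> Tp i x = x"
  using s_order t_order s_closed t_closed
  by (auto simp: Sp_def Tp_def dvd_def int_pow_pow[symmetric])

lemma Sp_mod: "x \<in> C \<Longrightarrow> Sp (i mod int p) x = Sp i x"
  and Tp_mod: "x \<in> C \<Longrightarrow> Tp (i mod int q) x = Tp i x"
  using Sp_dvd[of "- (int p * (i div int p))" x] Tp_dvd[of "- (int q * (i div int q))" x]
    Sp_Sp[of x i "- (int p * (i div int p))"] Tp_Tp[of x i "- (int q * (i div int q))"]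
  by (simp_all add: minus_mult_div_eq_mod[symmetric])

lemma Sp_eq_Tp: "Sp i x = Tp j x \<Longrightarrow> x \<in> C \<Longrightarrow> int p dvd i \<and> int q dvd j"
  using independent s_closed t_closed by (simp add: Sp_def Tp_def)

lemma Sp_Tp_fixed: "Sp i x = Tp j x \<Longrightarrow> x \<in> C \<Longrightarrow> Sp i x = x"
  using Sp_eq_Tp Sp_dvd by blast

text \<open>Factoring \<open>y x^-1\<close> as \<open>s^i t^j\<close> gives
  \<open>s^(-i) y = t^j x\<close>. So every coset of the powers of \<open>t\<close> meets every
  coset of the powers of \<open>s\<close>.\<close>

lemma exists_common: "x \<in> C \<Longrightarrow> y \<in> C \<Longrightarrow> \<exists>i j. Tp j x = Sp i y"
proof -
  assume xy: "x \<in> C" "y \<in> C"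
  have "y \<otimes> inv x \<in> C" using xy by simp
  then obtain i j :: int where ij: "y \<otimes> inv x = s [^] i \<otimes> t [^] j"
    using factorisation[of "y \<otimes> inv x"] xy by blast
  have "y = Sp i (Tp j x)"
    using arg_cong[OF ij, of "\<lambda>z. z \<otimes> x"] xy s_closed t_closed
    by (simp add: Sp_def Tp_def m_assoc)
  then have "Sp (-i) y = Tp j x" using xy by simp
  then show ?thesis by metis
qed

lemma card_carrier: "finite C \<and> card C = p * q"
proof -
  let ?f = "\<lambda>(i, j). Sp i (Tp j \<one>)"
  let ?A = "{0..<int p} \<times> {0..<int q}"
  have "?f ` ?A = C"
  proof (intro equalityI subsetI)
    fix x assume x: "x \<in> C"
    then obtain i j :: int where "x = s [^] i \<otimes> t [^] j" using factorisation by blast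
    then have "x = Sp (i mod int p) (Tp (j mod int q) \<one>)"
      by (subst Sp_mod, simp, subst Tp_mod) (auto simp: Sp_def Tp_def t_closed)
    moreover have "(i mod int p, j mod int q) \<in> ?A" using p_gt_1 q_gt_1 by simp
    ultimately show "x \<in> ?f ` ?A" by (auto intro!: image_eqI[of _ _ "(i mod int p, j mod int q)"])
  qed auto
  moreover have "inj_on ?f ?A"
  proof (rule inj_onI, clarify)
    fix i j k l assume r: "i \<in> {0..<int p}" "j \<in> {0..<int q}" "k \<in> {0..<int p}" "l \<in> {0..<int q}"
      and eq: "Sp i (Tp j \<one>) = Sp k (Tp l \<one>)"
    \<comment> \<open>The powers of \<open>s\<close> and of \<open>t\<close> are brought to opposite
      sides in front of the same element, as \<open>Sp_eq_Tp\<close> requires.\<close>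
    have "Sp (i - k) (Tp j \<one>) = Tp (l - j) (Tp j \<one>)"
      using arg_cong[OF eq, of "Sp (-k)"] by simp
    then have "int p dvd i - k \<and> int q dvd l - j" by (rule Sp_eq_Tp) simp
    then have "i mod int p = k mod int p" "l mod int q = j mod int q"
      by (simp_all add: mod_eq_dvd_iff)
    then show "i = k \<and> j = l" using r by simp
  qed
  ultimately have "bij_betw ?f ?A C" by (simp add: bij_betw_def)
  then show ?thesis using bij_betw_finite bij_betw_same_card by fastforce
qed

lemma finite_C: "finite C" using card_carrier by blast

text \<open>The right cosets of \<open>\<langle>t\<rangle>\<close>, \<open>\<langle>s t\<rangle>\<close> and \<open>\<langle>s\<rangle>\<close> through \<open>x\<close>, encoded as natural numbers whose
  residue modulo 3 is the rank.\<close>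

definition code :: "'a set \<Rightarrow> nat" where "code = to_nat_on (Pow C)"
definition V :: "'a \<Rightarrow> nat" where "V x = 3 * code (range (\<lambda>j. Tp j x))"
definition E :: "'a \<Rightarrow> nat" where "E x = 3 * code {x, Sp 1 (Tp 1 x)} + 1"
definition F :: "'a \<Rightarrow> nat" where "F x = 3 * code (range (\<lambda>i. Sp i x)) + 2"

section \<open>Equality of coset labels\<close>

lemma code_eq_iff: "X \<subseteq> C \<Longrightarrow> Y \<subseteq> C \<Longrightarrow> code X = code Y \<longleftrightarrow> X = Y"
  unfolding code_def using finite_C by (intro to_nat_on_inj) (auto intro: countable_finite)

lemma V_eq_iff: "x \<in> C \<Longrightarrow> y \<in> C \<Longrightarrow> V x = V y \<longleftrightarrow> (\<exists>j. y = Tp j x)"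
proof -
  assume xy: "x \<in> C" "y \<in> C"
  have "V x = V y \<longleftrightarrow> range (\<lambda>j. Tp j x) = range (\<lambda>j. Tp j y)"
    unfolding V_def using xy by (subst code_eq_iff[symmetric]) auto
  also have "\<dots> \<longleftrightarrow> (\<exists>j. y = Tp j x)"
  proof
    assume "range (\<lambda>j. Tp j x) = range (\<lambda>j. Tp j y)"
    moreover have "y \<in> range (\<lambda>j. Tp j y)" using xy by (auto intro: image_eqI[of _ _ 0])
    ultimately show "\<exists>j. y = Tp j x" by auto
  next
    assume "\<exists>j. y = Tp j x"
    then obtain j where j: "y = Tp j x" by blast
    have "Tp k x \<in> range (\<lambda>j. Tp j y)" "Tp k y \<in> range (\<lambda>j. Tp j x)" for k
      using j xy by (auto intro: range_eqI[of _ _ "k - j"])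
    then show "range (\<lambda>j. Tp j x) = range (\<lambda>j. Tp j y)" by blast
  qed
  finally show ?thesis .
qed

lemma F_eq_iff: "x \<in> C \<Longrightarrow> y \<in> C \<Longrightarrow> F x = F y \<longleftrightarrow> (\<exists>i. y = Sp i x)"
proof -
  assume xy: "x \<in> C" "y \<in> C"
  have "F x = F y \<longleftrightarrow> range (\<lambda>i. Sp i x) = range (\<lambda>i. Sp i y)"
    unfolding F_def using xy by (subst code_eq_iff[symmetric]) auto
  also have "\<dots> \<longleftrightarrow> (\<exists>i. y = Sp i x)"
  proof
    assume "range (\<lambda>j. Sp j x) = range (\<lambda>j. Sp j y)"
    moreover have "y \<in> range (\<lambda>j. Sp j y)" using xy by (auto intro: image_eqI[of _ _ 0])
    ultimately show "\<exists>j. y = Sp j x" by auto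
  next
    assume "\<exists>j. y = Sp j x"
    then obtain j where j: "y = Sp j x" by blast
    have "Sp k x \<in> range (\<lambda>j. Sp j y)" "Sp k y \<in> range (\<lambda>j. Sp j x)" for k
      using j xy by (auto intro: range_eqI[of _ _ "k - j"])
    then show "range (\<lambda>j. Sp j x) = range (\<lambda>j. Sp j y)" by blast
  qed
  finally show ?thesis .
qed

lemma ST_ST [simp]: "x \<in> C \<Longrightarrow> Sp 1 (Tp 1 (Sp 1 (Tp 1 x))) = x"
  using ST[of "Sp 1 (Tp 1 x)"] by simp

lemma E_eq_iff: "x \<in> C \<Longrightarrow> y \<in> C \<Longrightarrow> E x = E y \<longleftrightarrow> y = x \<or> y = Sp 1 (Tp 1 x)"
proof -
  assume xy: "x \<in> C" "y \<in> C"
  have "E x = E y \<longleftrightarrow> {x, Sp 1 (Tp 1 x)} = {y, Sp 1 (Tp 1 y)}"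
    unfolding E_def using xy by (subst code_eq_iff[symmetric]) auto
  also have "\<dots> \<longleftrightarrow> y = x \<or> y = Sp 1 (Tp 1 x)" using xy by auto
  finally show ?thesis .
qed

lemma V_Tp [simp]: "x \<in> C \<Longrightarrow> V (Tp j x) = V x" by (metis Tp_closed V_eq_iff)
lemma F_Sp [simp]: "x \<in> C \<Longrightarrow> F (Sp i x) = F x" by (metis Sp_closed F_eq_iff)
lemma E_ST [simp]: "x \<in> C \<Longrightarrow> E (Sp 1 (Tp 1 x)) = E x" by (metis Sp_closed Tp_closed E_eq_iff)

text \<open>Since \<open>s t x = t^-1 s^-1 x\<close> and the outer \<open>t^-1\<close> stays in the
  coset, the second vertex of the edge of \<open>x\<close> is that of \<open>s^-1 x\<close>.\<close>

lemma V_ST [simp]: "x \<in> C \<Longrightarrow> V (Sp 1 (Tp 1 x)) = V (Sp (-1) x)" by (simp add: ST)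

lemma VF_inj: "V x = V y \<Longrightarrow> F x = F y \<Longrightarrow> x \<in> C \<Longrightarrow> y \<in> C \<Longrightarrow> x = y"
  using V_eq_iff F_eq_iff Sp_Tp_fixed by metis

lemma VF_meet: "x \<in> C \<Longrightarrow> y \<in> C \<Longrightarrow> \<exists>z\<in>C. V z = V x \<and> F z = F y"
  using exists_common[of x y] by (metis F_Sp Sp_closed V_Tp)

lemma V_Sp_eq: "x \<in> C \<Longrightarrow> V (Sp i x) = V x \<Longrightarrow> int p dvd i"
  using V_eq_iff[of x "Sp i x"] Sp_eq_Tp[of i x] by auto

lemma F_Tp_eq: "x \<in> C \<Longrightarrow> F (Tp j x) = F x \<Longrightarrow> int q dvd j"
  using F_eq_iff[of x "Tp j x"] Sp_eq_Tp[of _ x j] by (metis Tp_closed)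

lemma V_Sp_neq: "x \<in> C \<Longrightarrow> V (Sp 1 x) \<noteq> V x" "x \<in> C \<Longrightarrow> V (Sp (-1) x) \<noteq> V x"
  using V_Sp_eq[of x 1] V_Sp_eq[of x "-1"] p_gt_1 by auto

lemma F_Tp_neq: "x \<in> C \<Longrightarrow> F (Tp 1 x) \<noteq> F x" "x \<in> C \<Longrightarrow> F (Tp (-1) x) \<noteq> F x"
  using F_Tp_eq[of x 1] F_Tp_eq[of x "-1"] q_gt_1 by auto

lemma E_Sp_eq: "x \<in> C \<Longrightarrow> E (Sp i x) = E (Sp k x) \<Longrightarrow> int p dvd i - k"
proof -
  assume x: "x \<in> C" and eq: "E (Sp i x) = E (Sp k x)"
  then consider "Sp k x = Sp i x" | "Sp k x = Sp 1 (Tp 1 (Sp i x))"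
    using E_eq_iff by auto
  then show ?thesis
  proof cases
    case 1
    then have "Sp (-k) (Sp i x) = Sp (-k) (Sp k x)" by simp
    then have "Sp (i - k) x = x" using x by simp
    then show ?thesis using V_Sp_eq[of x] x by simp
  next
    case 2
    \<comment> \<open>Taking faces removes the outer powers of \<open>s\<close>; the resulting
      equality is impossible because \<open>q > 1\<close>.\<close>
    have "F (Tp 1 (Sp i x)) = F (Sp i x)"
      using arg_cong[OF 2, of F] x by simp
    then show ?thesis using F_Tp_neq(1)[of "Sp i x"] x by simp
  qed
qed

lemma E_Tp_eq: "x \<in> C \<Longrightarrow> E (Tp i x) = E (Tp k x) \<Longrightarrow> int q dvd i - k"
proof -
  assume x: "x \<in> C" and eq: "E (Tp i x) = E (Tp k x)"
  then consider "Tp k x = Tp i x" | "Tp k x = Sp 1 (Tp 1 (Tp i x))"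
    using E_eq_iff by auto
  then show ?thesis
  proof cases
    case 1
    then have "Tp (-k) (Tp i x) = Tp (-k) (Tp k x)" by simp
    then have "Tp (i - k) x = x" using x by simp
    then show ?thesis using F_Tp_eq[of x] x by simp
  next
    case 2
    \<comment> \<open>Taking vertices turns \<open>s t\<close> into \<open>s^-1\<close>; the
      resulting equality is impossible because \<open>p > 1\<close>.\<close>
    have "V (Sp (-1) (Tp i x)) = V (Tp i x)"
      using arg_cong[OF 2, of V] x by (metis V_ST V_Tp Tp_closed)
    then show ?thesis using V_Sp_neq x by (metis Tp_closed)
  qed
qed

section \<open>The ranked poset of cosets and its flags\<close>

definition K :: "nat ranked_poset" where
  "K = \<lparr>elems = V ` C \<union> E ` C \<union> F ` C,
        order_rel = Id_on (V ` C \<union> E ` C \<union> F ` C) \<union> (\<lambda>x. (V x, E x)) ` C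
          \<union> (\<lambda>x. (E x, F x)) ` C \<union> (\<lambda>x. (V x, F x)) ` C,
        rank = (\<lambda>n. n mod 3)\<rparr>"

lemma V_mod [simp]: "V x mod 3 = 0" by (simp add: V_def)
lemma E_mod [simp]: "E x mod 3 = 1" unfolding E_def by presburger
lemma F_mod [simp]: "F x mod 3 = 2" unfolding F_def by presburger

lemma VEF_distinct [simp]: "V x \<noteq> E y" "E y \<noteq> V x" "E x \<noteq> F y" "F y \<noteq> E x" "V x \<noteq> F y" "F y \<noteq> V x"
  by (metis V_mod E_mod F_mod zero_neq_one zero_neq_numeral one_eq_numeral_iff num.distinct(1))+

lemma K_simps [simp]:
  "elems K = V ` C \<union> E ` C \<union> F ` C"
  "rank K n = n mod 3"
  by (simp_all add: K_def)

lemma of_rank_K [simp]: "of_rank K 0 = V ` C" "of_rank K 1 = E ` C" "of_rank K (Suc 0) = E ` C" "of_rank K 2 = F ` C"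
  by (auto simp: of_rank_def dvd_eq_mod_eq_0)

lemma VE_order: "x \<in> C \<Longrightarrow> y \<in> C \<Longrightarrow> (V x, E y) \<in> order_rel K \<longleftrightarrow> V x = V y \<or> V x = V (Sp (-1) y)"
proof -
  assume xy: "x \<in> C" "y \<in> C"
  have "(V x, E y) \<in> order_rel K \<longleftrightarrow> (\<exists>z\<in>C. V x = V z \<and> E y = E z)"
    by (auto simp: K_def)
  also have "\<dots> \<longleftrightarrow> V x = V y \<or> V x = V (Sp 1 (Tp 1 y))"
    using xy E_eq_iff by (metis Sp_closed Tp_closed)
  finally show ?thesis using xy by simp
qed

lemma EF_order: "x \<in> C \<Longrightarrow> y \<in> C \<Longrightarrow> (E x, F y) \<in> order_rel K \<longleftrightarrow> F y = F x \<or> F y = F (Tp 1 x)"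
proof -
  assume xy: "x \<in> C" "y \<in> C"
  have "(E x, F y) \<in> order_rel K \<longleftrightarrow> (\<exists>z\<in>C. F y = F z \<and> E x = E z)"
    by (auto simp: K_def)
  also have "\<dots> \<longleftrightarrow> F y = F x \<or> F y = F (Sp 1 (Tp 1 x))"
    using xy E_eq_iff by (metis Sp_closed Tp_closed)
  finally show ?thesis using xy by simp
qed

text \<open>The two cosets share an element by \<open>VF_meet\<close>. This complete incidence
  yields transitivity of the order and short paths for connectedness.\<close>

lemma VF_order: "x \<in> C \<Longrightarrow> y \<in> C \<Longrightarrow> (V x, F y) \<in> order_rel K"
  using VF_meet[of x y] by (auto simp: K_def) (metis (no_types, lifting) image_eqI)

lemma order_K_less: "(m, n) \<in> order_rel K \<Longrightarrow> m \<noteq> n \<Longrightarrow> m mod 3 < n mod 3"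
  by (auto simp: K_def)

lemma incident_K [simp]:
  assumes "x \<in> C" "y \<in> C"
  shows "incident K (V x) (E y) \<longleftrightarrow> V x = V y \<or> V x = V (Sp (-1) y)"
    and "incident K (E y) (F x) \<longleftrightarrow> F x = F y \<or> F x = F (Tp 1 y)"
    and "incident K (V x) (F y)"
  using VE_order EF_order VF_order order_K_less[of "E y" "V x"] order_K_less[of "F x" "E y"] assms
  by (auto simp: incident_def)

lemma incident_K_commuted [simp]:
  assumes "x \<in> C" "y \<in> C"
  shows "incident K (E y) (V x) \<longleftrightarrow> V x = V y \<or> V x = V (Sp (-1) y)"
    and "incident K (F x) (E y) \<longleftrightarrow> F x = F y \<or> F x = F (Tp 1 y)"
    and "incident K (F y) (V x)"
  using incident_K[OF assms] incident_commute by metis+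

text \<open>A vertex and a face share exactly one group element \<open>x\<close>, and \<open>W x\<close> and \<open>B x\<close> are the two flags
  containing both.\<close>

definition W :: "'a \<Rightarrow> nat flag" where "W x = (V x, E x, F x)"
definition B :: "'a \<Rightarrow> nat flag" where "B x = (V x, E (Sp 1 x), F x)"

text \<open>Take the representative \<open>e\<close> of the edge that lies over the vertex of
  \<open>x\<close>. The face of \<open>x\<close> is that of \<open>e\<close> or of
  \<open>t e\<close>, so \<open>x = e\<close> or \<open>x = t e\<close>; in the second case the edge
  is that of \<open>s t e = s x\<close>.\<close>

lemma VF_edges:
  assumes "x \<in> C" "y \<in> C"
  shows "incident K (V x) (E y) \<and> incident K (E y) (F x) \<longleftrightarrow> E y = E x \<or> E y = E (Sp 1 x)"
proof
  assume inc: "incident K (V x) (E y) \<and> incident K (E y) (F x)"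
  have "V x = V y \<or> V x = V (Sp 1 (Tp 1 y))" using assms inc by simp
  then obtain e where e: "e \<in> C" "E e = E y" "V e = V x"
    using assms by (metis E_ST Sp_closed Tp_closed)
  then have "F x = F e \<or> F x = F (Tp 1 e)" using inc assms by (metis incident_K(2))
  then show "E y = E x \<or> E y = E (Sp 1 x)"
  proof
    assume "F x = F e"
    then show ?thesis using VF_inj e assms by metis
  next
    assume "F x = F (Tp 1 e)"
    then have "x = Tp 1 e" using VF_inj[of x "Tp 1 e"] e assms by simp
    then show ?thesis using e by simp
  qed
next
  have "V x = V (Tp (-1) x)" "F x = F (Sp 1 x)" "V x = V (Sp (-1) (Sp 1 x))" using assms by simp_all
  then show "E y = E x \<or> E y = E (Sp 1 x) \<Longrightarrow> incident K (V x) (E y) \<and> incident K (E y) (F x)"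
    using assms by (metis incident_K(1,2) Sp_closed)
qed

lemma flags_K: "flags K = W ` C \<union> B ` C"
proof (intro equalityI subsetI)
  fix \<Phi> assume "\<Phi> \<in> flags K"
  then obtain a b c where abc: "\<Phi> = (V a, E b, F c)" "a \<in> C" "b \<in> C" "c \<in> C"
    and inc: "incident K (V a) (E b)" "incident K (E b) (F c)"
    by (auto simp: flags_def)
  obtain x where x: "x \<in> C" "V x = V a" "F x = F c" using VF_meet abc by blast
  then have "E b = E x \<or> E b = E (Sp 1 x)" using VF_edges[of x b] inc abc by metis
  then have "\<Phi> = W x \<or> \<Phi> = B x" using x abc by (simp add: W_def B_def)
  then show "\<Phi> \<in> W ` C \<union> B ` C" using x by blast
next
  fix \<Phi> assume "\<Phi> \<in> W ` C \<union> B ` C"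
  then obtain x where x: "x \<in> C" "\<Phi> = W x \<or> \<Phi> = B x" by auto
  then show "\<Phi> \<in> flags K"
    by (auto simp: W_def B_def flags_def)
qed

lemma W_flag [simp]: "x \<in> C \<Longrightarrow> W x \<in> flags K" and B_flag [simp]: "x \<in> C \<Longrightarrow> B x \<in> flags K"
  by (simp_all add: flags_K)

lemma E_Sp_neq: "x \<in> C \<Longrightarrow> E (Sp 1 x) \<noteq> E x"
  using E_Sp_eq[of x 1 0] p_gt_1 by auto

lemma W_inj: "W x = W y \<Longrightarrow> x \<in> C \<Longrightarrow> y \<in> C \<Longrightarrow> x = y"
  and B_inj: "B x = B y \<Longrightarrow> x \<in> C \<Longrightarrow> y \<in> C \<Longrightarrow> x = y"
  by (auto simp: W_def B_def intro: VF_inj)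

lemma W_neq_B: "x \<in> C \<Longrightarrow> y \<in> C \<Longrightarrow> W x \<noteq> B y"
  using VF_inj[of x y] E_Sp_neq[of y] by (auto simp: W_def B_def)

lemma card_flags_K: "finite (flags K) \<and> card (flags K) = 2 * p * q"
proof -
  have "card (W ` C \<union> B ` C) = card (W ` C) + card (B ` C)"
    using finite_C W_neq_B by (intro card_Un_disjoint finite_imageI) blast+
  also have "\<dots> = p * q + p * q"
    using card_carrier W_inj B_inj by (simp add: card_image inj_on_def)
  finally show ?thesis using finite_C by (simp add: flags_K)
qed

section \<open>The axioms of a polyhedron\<close>

lemma partial_order_K: "partial_order_on (elems K) (order_rel K)"
proof -
  have field: "order_rel K \<subseteq> elems K \<times> elems K" by (auto simp: K_def)
  have "refl_on (elems K) (order_rel K)" by (auto simp: K_def refl_on_def)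
  moreover have "antisym (order_rel K)"
    by (rule antisymI) (metis order_K_less less_asym)
  moreover have "trans (order_rel K)"
  proof (rule transI)
    fix a b c assume ab: "(a, b) \<in> order_rel K" and bc: "(b, c) \<in> order_rel K"
    show "(a, c) \<in> order_rel K"
    proof (cases "a = b \<or> b = c")
      case False
      \<comment> \<open>Two strict steps pass through the ranks 0, 1, 2, so the ends are a vertex
        and a face, and those are always related.\<close>
      then have "a mod 3 < b mod 3" "b mod 3 < c mod 3" using ab bc order_K_less by auto
      then have "a mod 3 = 0" "c mod 3 = 2" by linarith+
      moreover have "a \<in> elems K" "c \<in> elems K" using ab bc field by blast+
      ultimately have "a \<in> of_rank K 0" "c \<in> of_rank K 2" unfolding of_rank_def by simp_all
      then show ?thesis using VF_order by auto
    qed (use ab bc in auto)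
  qed
  ultimately show ?thesis using field by (simp add: partial_order_on_def preorder_on_def)
qed

lemma edge_vertices: "x \<in> C \<Longrightarrow> {v \<in> V ` C. incident K v (E x)} = {V x, V (Sp (-1) x)}"
  by auto

lemma edge_faces: "x \<in> C \<Longrightarrow> {f \<in> F ` C. incident K (E x) f} = {F x, F (Tp 1 x)}"
  by auto

lemma VF_edge_set:
  "x \<in> C \<Longrightarrow> {e \<in> E ` C. incident K (V x) e \<and> incident K e (F x)} = {E x, E (Sp 1 x)}"
  using VF_edges[of x] Sp_closed[of x 1] by blast

text \<open>Of the two representatives of an incident edge, one lies in the coset of the powers of
  \<open>s\<close> through \<open>x\<close>.\<close>

lemma face_edges: "x \<in> C \<Longrightarrow> {e \<in> E ` C. incident K e (F x)} = range (\<lambda>i. E (Sp i x))"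
proof (intro equalityI subsetI)
  fix e assume x: "x \<in> C" and "e \<in> {e \<in> E ` C. incident K e (F x)}"
  then obtain y where y: "y \<in> C" "e = E y" "F x = F y \<or> F x = F (Sp 1 (Tp 1 y))" by auto
  then obtain y' where "y' \<in> C" "e = E y'" "F x = F y'" by (metis E_ST Sp_closed Tp_closed)
  then show "e \<in> range (\<lambda>i. E (Sp i x))" using x F_eq_iff by auto
qed auto

lemma vertex_edges: "x \<in> C \<Longrightarrow> {e \<in> E ` C. incident K (V x) e} = range (\<lambda>i. E (Tp i x))"
proof (intro equalityI subsetI)
  fix e assume x: "x \<in> C" and "e \<in> {e \<in> E ` C. incident K (V x) e}"
  then obtain y where y: "y \<in> C" "e = E y" "V x = V y \<or> V x = V (Sp 1 (Tp 1 y))" by auto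
  then obtain y' where "y' \<in> C" "e = E y'" "V x = V y'" by (metis E_ST Sp_closed Tp_closed)
  then show "e \<in> range (\<lambda>i. E (Tp i x))" using x V_eq_iff by auto
qed auto

lemma has_type_K: "has_type K p q"
proof -
  have "finite (range (\<lambda>i. E (Sp i x))) \<and> card (range (\<lambda>i. E (Sp i x))) = p" if "x \<in> C" for x
    using that p_gt_1 by (intro card_periodic_range) (auto simp: Sp_mod dest: E_Sp_eq)
  moreover have "finite (range (\<lambda>i. E (Tp i x))) \<and> card (range (\<lambda>i. E (Tp i x))) = q" if "x \<in> C" for x
    using that q_gt_1 by (intro card_periodic_range) (auto simp: Tp_mod dest: E_Tp_eq)
  ultimately show ?thesis
    unfolding has_type_def by (auto simp: face_edges vertex_edges)
qed

lemma connected_K: "incidence_connected K (elems K)"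
proof (rule incidence_connectedI[of "V \<one>"])
  let ?r = "{(u, v). u \<in> elems K \<and> v \<in> elems K \<and> incident K u v}"
  fix y assume "y \<in> elems K"
  then consider x where "x \<in> C" "y = V x" | x where "x \<in> C" "y = E x" | x where "x \<in> C" "y = F x"
    by auto
  then show "(V \<one>, y) \<in> ?r\<^sup>*"
  proof cases
    case 1
    then have "(V \<one>, F \<one>) \<in> ?r" "(F \<one>, y) \<in> ?r" by simp_all
    then show ?thesis by (meson r_into_rtrancl rtrancl_trans)
  next
    case 2
    then have "(V \<one>, F x) \<in> ?r" "(F x, y) \<in> ?r" by simp_all
    then show ?thesis by (meson r_into_rtrancl rtrancl_trans)
  next
    case 3
    then have "(V \<one>, y) \<in> ?r" by simp
    then show ?thesis by (meson r_into_rtrancl)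
  qed
qed simp

text \<open>Faces and edges alternate along \<open>F (t^i x)\<close>, \<open>E (t^i x)\<close>,
  \<open>F (t^(i+1) x)\<close>. Every face occurs in this sequence because its coset meets that of
  the powers of \<open>t\<close> through \<open>x\<close>.\<close>

lemma connected_vertex_figure:
  assumes x: "x \<in> C"
  shows "incidence_connected K (neighbours K (V x))"
proof (rule incidence_connectedI[of "F x"])
  let ?r = "{(u, v). u \<in> neighbours K (V x) \<and> v \<in> neighbours K (V x) \<and> incident K u v}"
  have nF: "F z \<in> neighbours K (V x)" if "z \<in> C" for z using that x by (simp add: neighbours_def)
  have nE: "E (Tp i x) \<in> neighbours K (V x)" for i using x by (simp add: neighbours_def)
  show "F x \<in> neighbours K (V x)" using nF x by blast
  have FE: "(F (Tp i x), E (Tp i x)) \<in> ?r" "(E (Tp i x), F (Tp i x)) \<in> ?r"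
    "(F (Tp (i + 1) x), E (Tp i x)) \<in> ?r" "(E (Tp i x), F (Tp (i + 1) x)) \<in> ?r" for i
    using nF nE x by (simp_all add: add.commute)
  have F_conn: "(F x, F (Tp i x)) \<in> ?r\<^sup>*" for i
  proof -
    have "(F (Tp i x), F (Tp (i + 1) x)) \<in> ?r\<^sup>*" for i
      using FE(1)[of i] FE(4)[of i] by (rule converse_rtrancl_into_rtrancl[OF _ r_into_rtrancl])
    moreover have "(F (Tp (i + 1) x), F (Tp i x)) \<in> ?r\<^sup>*" for i
      using FE(3)[of i] FE(2)[of i] by (rule converse_rtrancl_into_rtrancl[OF _ r_into_rtrancl])
    ultimately show ?thesis using int_sequence_connected[of "\<lambda>i. F (Tp i x)" ?r i] x by simp
  qed
  fix y assume "y \<in> neighbours K (V x)"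
  then have "y \<in> {e \<in> E ` C. incident K (V x) e} \<or> y \<in> F ` C"
    unfolding neighbours_def using x order_K_less[of "V x" y] order_K_less[of y "V x"]
    by (auto simp: incident_def)
  then consider i where "y = E (Tp i x)" | z where "z \<in> C" "y = F z"
    using vertex_edges[OF x] by auto
  then show "(F x, y) \<in> ?r\<^sup>*"
  proof cases
    case 1
    then show ?thesis using F_conn[of i] FE(1)[of i] by (meson rtrancl.rtrancl_into_rtrancl)
  next
    case 2
    then obtain j where "F (Tp j x) = y" using exists_common[OF x, of z] by (metis F_Sp)
    then show ?thesis using F_conn by blast
  qed
qed

text \<open>The edge joining \<open>V (s^i x)\<close> and \<open>V (s^(i+1) x)\<close> is
  \<open>E (s^(i+1) x)\<close>. The index is shifted against the vertex figure because the second
  vertex of an edge is reached by \<open>s^-1\<close>.\<close>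

lemma connected_face:
  assumes x: "x \<in> C"
  shows "incidence_connected K (neighbours K (F x))"
proof (rule incidence_connectedI[of "V x"])
  let ?r = "{(u, v). u \<in> neighbours K (F x) \<and> v \<in> neighbours K (F x) \<and> incident K u v}"
  have nV: "V z \<in> neighbours K (F x)" if "z \<in> C" for z using that x by (simp add: neighbours_def)
  have nE: "E (Sp i x) \<in> neighbours K (F x)" for i using x by (simp add: neighbours_def)
  show "V x \<in> neighbours K (F x)" using nV x by blast
  have VE: "(V (Sp i x), E (Sp i x)) \<in> ?r" "(E (Sp i x), V (Sp i x)) \<in> ?r"
    "(V (Sp i x), E (Sp (i + 1) x)) \<in> ?r" "(E (Sp (i + 1) x), V (Sp i x)) \<in> ?r" for i
    using nV nE x by (simp_all)
  have V_conn: "(V x, V (Sp i x)) \<in> ?r\<^sup>*" for i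
  proof -
    have "(V (Sp i x), V (Sp (i + 1) x)) \<in> ?r\<^sup>*" for i
      using VE(3)[of i] VE(2)[of "i + 1"] by (rule converse_rtrancl_into_rtrancl[OF _ r_into_rtrancl])
    moreover have "(V (Sp (i + 1) x), V (Sp i x)) \<in> ?r\<^sup>*" for i
      using VE(1)[of "i + 1"] VE(4)[of i] by (rule converse_rtrancl_into_rtrancl[OF _ r_into_rtrancl])
    ultimately show ?thesis using int_sequence_connected[of "\<lambda>i. V (Sp i x)" ?r i] x by simp
  qed
  fix y assume "y \<in> neighbours K (F x)"
  then have "y \<in> {e \<in> E ` C. incident K e (F x)} \<or> y \<in> V ` C"
    unfolding neighbours_def using x order_K_less[of "F x" y] order_K_less[of y "F x"]
    by (auto simp: incident_def)
  then consider i where "y = E (Sp i x)" | z where "z \<in> C" "y = V z"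
    using face_edges[OF x] by auto
  then show "(V x, y) \<in> ?r\<^sup>*"
  proof cases
    case 1
    then show ?thesis using V_conn[of i] VE(1)[of i] by (meson rtrancl.rtrancl_into_rtrancl)
  next
    case 2
    then obtain j where "V (Sp j x) = y" using exists_common[of z x] x by (metis V_Tp)
    then show ?thesis using V_conn by blast
  qed
qed

lemma polyhedron_K: "polyhedron K"
  unfolding polyhedron_def
proof (intro conjI ballI impI)
  show "partial_order_on (elems K) (order_rel K)" by (rule partial_order_K)
  show "elems K \<noteq> {}" by auto
  show "rank K x \<in> {0, 1, 2}" if "x \<in> elems K" for x using that by auto
  show "case z of (x, y) \<Rightarrow> x \<noteq> y \<longrightarrow> rank K x < rank K y" if "z \<in> order_rel K" for z
    using that order_K_less by (cases z) simp
  show "card {v \<in> of_rank K 0. incident K v e} = 2" if "e \<in> of_rank K 1" for e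
  proof -
    obtain x where x: "x \<in> C" "e = E x" using \<open>e \<in> of_rank K 1\<close> by auto
    show ?thesis using x V_Sp_neq(2)[of x] edge_vertices[OF x(1)] by simp
  qed
  show "card {f \<in> of_rank K 2. incident K e f} = 2" if "e \<in> of_rank K 1" for e
  proof -
    obtain x where x: "x \<in> C" "e = E x" using \<open>e \<in> of_rank K 1\<close> by auto
    show ?thesis using x F_Tp_neq(1)[of x] edge_faces[OF x(1)] by simp
  qed
  show "card {e \<in> of_rank K 1. incident K v e \<and> incident K e f} = 2"
    if vf: "v \<in> of_rank K 0" "f \<in> of_rank K 2" for v f
  proof -
    obtain a b where ab: "a \<in> C" "b \<in> C" "v = V a" "f = F b" using vf by auto
    then obtain x where x: "x \<in> C" "v = V x" "f = F x" using VF_meet[of a b] by metis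
    show ?thesis using x E_Sp_neq[of x] VF_edge_set[OF x(1)] by simp
  qed
  show "incidence_connected K (elems K)" by (rule connected_K)
  show "incidence_connected K (neighbours K x)" if "x \<in> of_rank K 0 \<union> of_rank K 2" for x
    using that connected_vertex_figure connected_face by auto
qed

section \<open>Adjacent flags\<close>

definition adjacent :: "nat \<Rightarrow> nat flag \<Rightarrow> nat flag \<Rightarrow> bool" where
  "adjacent i \<Phi> \<Psi> \<longleftrightarrow> (\<forall>j\<in>{0, 1, 2}. flag_elem \<Psi> j \<noteq> flag_elem \<Phi> j \<longleftrightarrow> j = i)"

lemma adjacent_sym: "adjacent i \<Phi> \<Psi> \<Longrightarrow> adjacent i \<Psi> \<Phi>"
  unfolding adjacent_def by metis

text \<open>Adjacency exchanges the two kinds of flags. For rank 0, \<open>s^-1 x\<close> has the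
  face of \<open>x\<close> and its flag \<open>B\<close> uses the edge of \<open>x\<close>; for rank
  2, \<open>t x\<close> has the vertex of \<open>x\<close>, and
  \<open>E (s t x) = E x\<close>.\<close>

lemma adjacent_W:
  assumes "x \<in> C"
  shows "adjacent 0 (W x) (B (Sp (-1) x))" "adjacent 1 (W x) (B x)" "adjacent 2 (W x) (B (Tp 1 x))"
  using assms V_Sp_neq F_Tp_neq E_Sp_neq by (auto simp: adjacent_def W_def B_def)

lemma adjacent_B:
  assumes "x \<in> C"
  shows "adjacent 0 (B x) (W (Sp 1 x))" "adjacent 1 (B x) (W x)" "adjacent 2 (B x) (W (Tp (-1) x))"
  using assms adjacent_W[of "Sp 1 x"] adjacent_W[of "x"] adjacent_W[of "Tp (-1) x"] adjacent_sym
  by auto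

lemma adj_flag_K: "\<Phi> \<in> flags K \<Longrightarrow> \<Psi> \<in> flags K \<Longrightarrow> i \<in> {0, 1, 2} \<Longrightarrow> adjacent i \<Phi> \<Psi> \<Longrightarrow> adj_flag K i \<Phi> = \<Psi>"
  unfolding adjacent_def by (rule adj_flag_eqI[OF polyhedron_K])

lemma adj_flag_W:
  assumes "x \<in> C"
  shows "adj_flag K 0 (W x) = B (Sp (-1) x)" "adj_flag K 1 (W x) = B x" "adj_flag K (Suc 0) (W x) = B x"
    "adj_flag K 2 (W x) = B (Tp 1 x)"
  using assms adjacent_W adj_flag_K by simp_all

lemma adj_flag_B:
  assumes "x \<in> C"
  shows "adj_flag K 0 (B x) = W (Sp 1 x)" "adj_flag K 1 (B x) = W x" "adj_flag K (Suc 0) (B x) = W x"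
    "adj_flag K 2 (B x) = W (Tp (-1) x)"
  using assms adjacent_B adj_flag_K by simp_all

section \<open>Automorphisms are determined by the image of one flag\<close>

lemma aut_adj_flag:
  assumes "g \<in> carrier (aut_group K)" "\<Phi> \<in> flags K" "i \<in> {0, 1, 2}"
  shows "flag_image g (adj_flag K i \<Phi>) = adj_flag K i (flag_image g \<Phi>)"
proof -
  obtain \<Psi> where \<Psi>: "\<Psi> \<in> flags K" "adjacent i \<Phi> \<Psi>"
  proof -
    consider x where "x \<in> C" "\<Phi> = W x" | x where "x \<in> C" "\<Phi> = B x" using assms(2) flags_K by auto
    then show ?thesis
    proof cases
      case 1
      then show ?thesis using assms(3) adjacent_W[of x] that[of "B (Sp (-1) x)"] that[of "B x"]
          that[of "B (Tp 1 x)"] by auto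
    next
      case 2
      then show ?thesis using assms(3) adjacent_B[of x] that[of "W (Sp 1 x)"] that[of "W x"]
          that[of "W (Tp (-1) x)"] by auto
    qed
  qed
  then show ?thesis
    using aut_group_adj_flag[OF polyhedron_K assms(1,2) \<Psi>(1) assms(3)] adj_flag_K[of \<Phi> \<Psi> i] assms
    by (simp add: adjacent_def)
qed

text \<open>On the flags \<open>W x\<close>, left multiplication by a generator is a pair of
  adjacency steps, and automorphisms commute with adjacency.\<close>

lemma aut_W_step:
  assumes g: "g \<in> carrier (aut_group K)" and x: "x \<in> C"
  shows "flag_image g (W (Sp 1 x)) = adj_flag K 0 (adj_flag K 1 (flag_image g (W x)))"
    and "flag_image g (W (Tp 1 x)) = adj_flag K 1 (adj_flag K 2 (flag_image g (W x)))"
proof -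
  have "W (Sp 1 x) = adj_flag K 0 (adj_flag K 1 (W x))" "W (Tp 1 x) = adj_flag K 1 (adj_flag K 2 (W x))"
    using x by (simp_all add: adj_flag_W adj_flag_B)
  moreover have "adj_flag K 1 (W x) \<in> flags K" "adj_flag K 2 (W x) \<in> flags K"
    using x by (simp_all add: adj_flag_W)
  ultimately show "flag_image g (W (Sp 1 x)) = adj_flag K 0 (adj_flag K 1 (flag_image g (W x)))"
    "flag_image g (W (Tp 1 x)) = adj_flag K 1 (adj_flag K 2 (flag_image g (W x)))"
    using aut_adj_flag[OF g] W_flag[OF x] by (metis insertI1 insertI2)+
qed

text \<open>The generators have finite order, so no steps for their inverses are needed.\<close>

lemma carrier_induct [consumes 1, case_names one Sp Tp]:
  assumes "x \<in> C" "P \<one>" "\<And>x. x \<in> C \<Longrightarrow> P x \<Longrightarrow> P (Sp 1 x)" "\<And>x. x \<in> C \<Longrightarrow> P x \<Longrightarrow> P (Tp 1 x)"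
  shows "P x"
proof -
  obtain i j :: int where ij: "x = s [^] i \<otimes> t [^] j" using factorisation assms(1) by blast
  then have "x = Sp (i mod int p) (Tp (j mod int q) \<one>)"
    by (subst Sp_mod, simp, subst Tp_mod) (auto simp: Sp_def Tp_def t_closed)
  moreover have "i mod int p \<ge> 0" "j mod int q \<ge> 0" using p_gt_1 q_gt_1 by simp_all
  then obtain m n where "i mod int p = int m" "j mod int q = int n" by (metis nonneg_int_cases)
  moreover have Q: "P (Tp (int n) \<one>)" for n
  proof (induction n)
    case (Suc n)
    then show ?case using assms(4)[of "Tp (int n) \<one>"] by (simp add: add.commute)
  qed (simp add: assms(2))
  have "P (Sp (int m) (Tp (int n) \<one>))" for m n
  proof (induction m)
    case (Suc m)
    then show ?case using assms(3)[of "Sp (int m) (Tp (int n) \<one>)"] by (simp add: add.commute)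
  qed (simp add: Q)
  ultimately show ?thesis by simp
qed

lemma aut_eq_on_flags:
  assumes "x \<in> C" "g \<in> carrier (aut_group K)" "g' \<in> carrier (aut_group K)"
    "flag_image g (W \<one>) = flag_image g' (W \<one>)"
  shows "flag_image g (W x) = flag_image g' (W x)"
  using assms(1) by (induction rule: carrier_induct) (simp_all add: aut_W_step assms)

text \<open>The image of the base flag propagates to all \<open>W x\<close>, and these contain every
  vertex, edge and face.\<close>

lemma aut_eqI:
  assumes "g \<in> carrier (aut_group K)" "g' \<in> carrier (aut_group K)"
    "flag_image g (W \<one>) = flag_image g' (W \<one>)"
  shows "g = g'"
proof (rule extensionalityI)
  show "g \<in> extensional (elems K)" "g' \<in> extensional (elems K)"
    using assms by (simp_all add: aut_group_def Bij_def)
  fix n assume "n \<in> elems K"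
  then obtain x where "x \<in> C" "n = V x \<or> n = E x \<or> n = F x" by auto
  then show "g n = g' n" using aut_eq_on_flags[of x g g'] assms by (auto simp: W_def)
qed

section \<open>Right multiplications and reflections\<close>

definition act :: "'a \<Rightarrow> nat \<Rightarrow> nat" where
  "act g = (\<lambda>n\<in>elems K.
     if n mod 3 = 0 then V (inv_into C V n \<otimes> g)
     else if n mod 3 = 1 then E (inv_into C E n \<otimes> g)
     else F (inv_into C F n \<otimes> g))"

lemma coset_labels_mult:
  assumes "x \<in> C" "y \<in> C" "g \<in> C"
  shows "V x = V y \<Longrightarrow> V (x \<otimes> g) = V (y \<otimes> g)" "E x = E y \<Longrightarrow> E (x \<otimes> g) = E (y \<otimes> g)"
    "F x = F y \<Longrightarrow> F (x \<otimes> g) = F (y \<otimes> g)"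
  using assms by (auto simp: V_eq_iff E_eq_iff F_eq_iff Sp_mult Tp_mult)

text \<open>By \<open>coset_labels_mult\<close>, right multiplication maps cosets to cosets, so the
  result is independent of the representative picked by \<open>inv_into\<close>.\<close>

lemma act_simps [simp]:
  assumes "x \<in> C" "g \<in> C"
  shows "act g (V x) = V (x \<otimes> g)" "act g (E x) = E (x \<otimes> g)" "act g (F x) = F (x \<otimes> g)"
proof -
  have "inv_into C V (V x) \<in> C" "V (inv_into C V (V x)) = V x"
    "inv_into C E (E x) \<in> C" "E (inv_into C E (E x)) = E x"
    "inv_into C F (F x) \<in> C" "F (inv_into C F (F x)) = F x"
    using assms by (simp_all add: inv_into_into f_inv_into_f)
  then show "act g (V x) = V (x \<otimes> g)" "act g (E x) = E (x \<otimes> g)" "act g (F x) = F (x \<otimes> g)"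
    using assms coset_labels_mult(1)[of "inv_into C V (V x)" x g]
      coset_labels_mult(2)[of "inv_into C E (E x)" x g] coset_labels_mult(3)[of "inv_into C F (F x)" x g]
    by (simp_all add: act_def)
qed

lemma act_extensional [simp]: "act g \<in> extensional (elems K)"
  unfolding act_def by (rule restrict_extensional)

lemma act_elems: "n \<in> elems K \<Longrightarrow> g \<in> C \<Longrightarrow> act g n \<in> elems K"
  by auto

lemma act_act: "n \<in> elems K \<Longrightarrow> g \<in> C \<Longrightarrow> h \<in> C \<Longrightarrow> act h (act g n) = act (g \<otimes> h) n"
  by (auto simp: m_assoc)

lemma act_one: "n \<in> elems K \<Longrightarrow> act \<one> n = n"
  by auto

lemma act_order: "(m, n) \<in> order_rel K \<Longrightarrow> g \<in> C \<Longrightarrow> (act g m, act g n) \<in> order_rel K"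
  by (auto simp: K_def Id_on_def)

lemma act_aut: "g \<in> C \<Longrightarrow> act g \<in> carrier (aut_group K)"
proof -
  assume g: "g \<in> C"
  have "bij_betw (act g) (elems K) (elems K)"
    by (rule bij_betw_byWitness[of _ "act (inv g)"])
      (use g act_act act_one act_elems in auto)
  \<comment> \<open>The converse implication is \<open>act_order\<close> for the inverse of
    \<open>g\<close>.\<close>
  moreover have "(m, n) \<in> order_rel K \<longleftrightarrow> (act g m, act g n) \<in> order_rel K"
    if "m \<in> elems K" "n \<in> elems K" for m n
    using act_order[of m n g] act_order[of "act g m" "act g n" "inv g"] g that
      act_act[of m g "inv g"] act_act[of n g "inv g"] act_one by (auto simp del: K_simps)
  ultimately show ?thesis by (simp add: aut_group_def Bij_def del: K_simps)
qed

lemma act_flags [simp]: "x \<in> C \<Longrightarrow> g \<in> C \<Longrightarrow> flag_image (act g) (W x) = W (x \<otimes> g)"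
    "x \<in> C \<Longrightarrow> g \<in> C \<Longrightarrow> flag_image (act g) (B x) = B (x \<otimes> g)"
  by (simp_all add: W_def B_def Sp_mult)

text \<open>The pairs of adjacency steps that multiply by \<open>s\<close> and \<open>t\<close> on
  flags \<open>W x\<close> multiply by their inverses on flags \<open>B y\<close>. So the
  automorphism sends \<open>W x\<close> to \<open>B (\<beta> x \<otimes> a)\<close>, where \<beta>
  inverts the generators letter by letter.\<close>

lemma aut_W_to_B:
  assumes g: "g \<in> carrier (aut_group K)" and W: "flag_image g (W \<one>) = B a" and a: "a \<in> C"
  shows "\<exists>\<beta>. \<beta> \<one> = \<one> \<and> (\<forall>x\<in>C. \<beta> x \<in> C \<and> \<beta> (s \<otimes> x) = inv s \<otimes> \<beta> x \<and> \<beta> (t \<otimes> x) = inv t \<otimes> \<beta> x)"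
proof -
  have "\<exists>y\<in>C. flag_image g (W x) = B (y \<otimes> a)" if "x \<in> C" for x
    using that
  proof (induction rule: carrier_induct)
    case one
    then show ?case using W a by (auto intro!: bexI[of _ \<one>])
  next
    case (Sp x)
    then obtain y where "y \<in> C" "flag_image g (W x) = B (y \<otimes> a)" by blast
    then show ?case using aut_W_step(1)[OF g Sp(1)] a
      by (auto simp: adj_flag_W adj_flag_B Sp_mult intro!: bexI[of _ "Sp (-1) y"])
  next
    case (Tp x)
    then obtain y where "y \<in> C" "flag_image g (W x) = B (y \<otimes> a)" by blast
    then show ?case using aut_W_step(2)[OF g Tp(1)] a
      by (auto simp: adj_flag_W adj_flag_B Tp_mult intro!: bexI[of _ "Tp (-1) y"])
  qed
  then obtain \<beta> where \<beta>: "\<And>x. x \<in> C \<Longrightarrow> \<beta> x \<in> C \<and> flag_image g (W x) = B (\<beta> x \<otimes> a)" by metis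
  have eq: "y = y'" if "B (y \<otimes> a) = B (y' \<otimes> a)" "y \<in> C" "y' \<in> C" for y y'
    using B_inj[OF that(1)] that a by simp
  have "\<beta> \<one> = \<one>" using eq[of "\<beta> \<one>" \<one>] \<beta>[of \<one>] W a by simp
  moreover have "\<beta> (Sp 1 x) = Sp (-1) (\<beta> x)" if "x \<in> C" for x
    using eq[of "\<beta> (Sp 1 x)" "Sp (-1) (\<beta> x)"] \<beta>[of x] \<beta>[of "Sp 1 x"] aut_W_step(1)[OF g that] that a
    by (simp add: adj_flag_W adj_flag_B Sp_mult)
  moreover have "\<beta> (Tp 1 x) = Tp (-1) (\<beta> x)" if "x \<in> C" for x
    using eq[of "\<beta> (Tp 1 x)" "Tp (-1) (\<beta> x)"] \<beta>[of x] \<beta>[of "Tp 1 x"] aut_W_step(2)[OF g that] that a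
    by (simp add: adj_flag_W adj_flag_B Tp_mult)
  ultimately show ?thesis
    using \<beta> s_closed t_closed by (intro exI[of _ \<beta>]) (auto simp: Sp_def Tp_def int_pow_neg)
qed

text \<open>Applying \<beta> to the first relation negates all exponents and gives
  \<open>t s^-1 = s^(-i1) t^(-j1)\<close>. Comparison with the second relation makes
  \<open>s^(i1 + i2)\<close> a power of \<open>t\<close>, and independence then forces the excluded
  divisibility.\<close>

lemma no_reflection_criterion:
  fixes i1 j1 i2 j2 :: int
  assumes rel1: "inv t \<otimes> s = s [^] i1 \<otimes> t [^] j1" and rel2: "t \<otimes> inv s = s [^] i2 \<otimes> t [^] j2"
    and ndvd: "\<not> int p dvd i1 + i2"
  shows "\<nexists>\<beta>. \<beta> \<one> = \<one> \<and>
    (\<forall>x\<in>C. \<beta> x \<in> C \<and> \<beta> (s \<otimes> x) = inv s \<otimes> \<beta> x \<and> \<beta> (t \<otimes> x) = inv t \<otimes> \<beta> x)"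
proof
  assume "\<exists>\<beta>. \<beta> \<one> = \<one> \<and>
    (\<forall>x\<in>C. \<beta> x \<in> C \<and> \<beta> (s \<otimes> x) = inv s \<otimes> \<beta> x \<and> \<beta> (t \<otimes> x) = inv t \<otimes> \<beta> x)"
  then obtain \<beta> where \<beta>_one: "\<beta> \<one> = \<one>" and \<beta>_closed: "\<And>x. x \<in> C \<Longrightarrow> \<beta> x \<in> C"
    and "\<And>x. x \<in> C \<Longrightarrow> \<beta> (s \<otimes> x) = inv s \<otimes> \<beta> x" "\<And>x. x \<in> C \<Longrightarrow> \<beta> (t \<otimes> x) = inv t \<otimes> \<beta> x"
    by blast
  then have S1: "\<beta> (Sp 1 x) = Sp (-1) (\<beta> x)" and T1: "\<beta> (Tp 1 x) = Tp (-1) (\<beta> x)" if "x \<in> C" for x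
    using that s_closed t_closed by (simp_all add: Sp_def Tp_def int_pow_neg)
  have \<beta>_Sp: "\<beta> (Sp i x) = Sp (-i) (\<beta> x)" if x: "x \<in> C" for i x
  proof (induction i rule: int_induct[of _ 0])
    case base
    then show ?case using x \<beta>_closed by simp
  next
    case (step1 i)
    then show ?case using S1[of "Sp i x"] x \<beta>_closed by (simp add: add.commute)
  next
    case (step2 i)
    have "Sp 1 (Sp (-1) (\<beta> (Sp (i - 1) x))) = Sp 1 (\<beta> (Sp i x))"
      using S1[of "Sp (i - 1) x"] x by simp
    then show ?case using step2 x \<beta>_closed by simp
  qed
  have \<beta>_Tp: "\<beta> (Tp i x) = Tp (-i) (\<beta> x)" if x: "x \<in> C" for i x
  proof (induction i rule: int_induct[of _ 0])
    case base
    then show ?case using x \<beta>_closed by simp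
  next
    case (step1 i)
    then show ?case using T1[of "Tp i x"] x \<beta>_closed by (simp add: add.commute)
  next
    case (step2 i)
    have "Tp 1 (Tp (-1) (\<beta> (Tp (i - 1) x))) = Tp 1 (\<beta> (Tp i x))"
      using T1[of "Tp (i - 1) x"] x by simp
    then show ?case using step2 x \<beta>_closed by simp
  qed
  have "Tp (-1) (Sp 1 \<one>) = Sp i1 (Tp j1 \<one>)" and r2: "Tp 1 (Sp (-1) \<one>) = Sp i2 (Tp j2 \<one>)"
    using rel1 rel2 s_closed t_closed by (simp_all add: Sp_def Tp_def int_pow_neg)
  then have "\<beta> (Tp (-1) (Sp 1 \<one>)) = \<beta> (Sp i1 (Tp j1 \<one>))" by simp
  then have "Sp i2 (Tp j2 \<one>) = Sp (-i1) (Tp (-j1) \<one>)"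
    by (simp add: \<beta>_Sp \<beta>_Tp \<beta>_one r2)
  then have "Sp i1 (Sp i2 (Tp j2 \<one>)) = Sp i1 (Sp (-i1) (Tp (-j1) \<one>))" by simp
  then have "Sp (i1 + i2) (Tp j2 \<one>) = Tp (-j1 - j2) (Tp j2 \<one>)" by simp
  then have "int p dvd i1 + i2 \<and> int q dvd - j1 - j2" by (rule Sp_eq_Tp) simp
  then show False using ndvd by blast
qed

end

section \<open>The full automorphism group and chirality\<close>

locale chiral_tight_rotation_group = tight_rotation_group +
  assumes no_reflection: "\<nexists>\<beta>. \<beta> \<one> = \<one> \<and>
    (\<forall>x\<in>carrier G. \<beta> x \<in> carrier G \<and> \<beta> (s \<otimes> x) = inv s \<otimes> \<beta> x \<and> \<beta> (t \<otimes> x) = inv t \<otimes> \<beta> x)"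
begin

text \<open>The base flag goes to some \<open>W a\<close> or \<open>B a\<close>. The second case
  would yield a reflection; in the first, \<open>act a\<close> has the same effect on the base
  flag.\<close>

lemma aut_is_act:
  assumes g: "g \<in> carrier (aut_group K)"
  shows "\<exists>a\<in>C. g = act a"
proof -
  have "flag_image g (W \<one>) \<in> flags K"
    using aut_group_flag_image_in_flags[OF polyhedron_K g] by simp
  then obtain a where a: "a \<in> C" "flag_image g (W \<one>) = W a \<or> flag_image g (W \<one>) = B a"
    by (auto simp: flags_K)
  then have "flag_image g (W \<one>) = W a" using aut_W_to_B[OF g _ a(1)] no_reflection by blast
  then have "g = act a" using aut_eqI[OF g act_aut] a by simp
  then show ?thesis using a by blast
qed

lemma act_iso: "act \<in> iso G (aut_group K)"
proof -
  have "act \<in> hom G (aut_group K)"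
  proof (rule homI)
    show "act g \<in> carrier (aut_group K)" if "g \<in> C" for g using that act_aut by blast
    \<comment> \<open>The product of \<open>aut_group\<close> applies the left factor first, which
      agrees with right multiplication.\<close>
    show "act (g \<otimes> h) = act g \<otimes>\<^bsub>aut_group K\<^esub> act h" if "g \<in> C" "h \<in> C" for g h
      using that act_act
      by (intro extensionalityI[of _ "elems K"])
        (simp_all add: aut_group_def compose_def del: K_simps)
  qed
  moreover have "inj_on act C"
  proof (rule inj_onI)
    fix a b assume ab: "a \<in> C" "b \<in> C" "act a = act b"
    then have "W a = W b" using act_flags(1)[of \<one> a] act_flags(1)[of \<one> b] by simp
    then show "a = b" using W_inj ab by blast
  qed
  moreover have "act ` C = carrier (aut_group K)" using act_aut aut_is_act by blast
  ultimately show ?thesis by (simp add: iso_def bij_betw_def)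
qed

lemma chiral_K: "chiral K"
  unfolding chiral_def
proof (intro conjI)
  show "polyhedron K" by (rule polyhedron_K)
  have trans: "\<exists>g\<in>carrier (aut_group K). flag_image g (W x) = W y"
      "\<exists>g\<in>carrier (aut_group K). flag_image g (B x) = B y" if "x \<in> C" "y \<in> C" for x y
    using that by (auto intro!: bexI[OF _ act_aut[of "inv x \<otimes> y"]] simp: m_assoc[symmetric])
  show "\<exists>X Y. X \<union> Y = flags K \<and> X \<inter> Y = {} \<and> X \<noteq> {} \<and> Y \<noteq> {} \<and>
        (\<forall>\<Phi>\<in>flags K. \<forall>i\<in>{0, 1, 2}. \<Phi> \<in> X \<longleftrightarrow> adj_flag K i \<Phi> \<in> Y) \<and>
        flag_transitive_on K X \<and> flag_transitive_on K Y"
  proof (intro exI conjI)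
    show "W ` C \<union> B ` C = flags K" by (simp add: flags_K)
    show disj: "W ` C \<inter> B ` C = {}" using W_neq_B by blast
    show "W ` C \<noteq> {}" "B ` C \<noteq> {}" by auto
    show "\<forall>\<Phi>\<in>flags K. \<forall>i\<in>{0, 1, 2}. \<Phi> \<in> W ` C \<longleftrightarrow> adj_flag K i \<Phi> \<in> B ` C"
    proof (intro ballI)
      fix \<Phi> and i :: nat assume "\<Phi> \<in> flags K" and i: "i \<in> {0, 1, 2}"
      then consider x where "x \<in> C" "\<Phi> = W x" | x where "x \<in> C" "\<Phi> = B x" by (auto simp: flags_K)
      then show "\<Phi> \<in> W ` C \<longleftrightarrow> adj_flag K i \<Phi> \<in> B ` C"
      proof cases
        case 1
        then have "adj_flag K i \<Phi> \<in> B ` C" using i adj_flag_W[of x] by auto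
        then show ?thesis using 1 by blast
      next
        case 2
        then have "adj_flag K i \<Phi> \<in> W ` C" using i adj_flag_B[of x] by auto
        then show ?thesis using 2 disj by blast
      qed
    qed
    show "flag_transitive_on K (W ` C)" "flag_transitive_on K (B ` C)"
      unfolding flag_transitive_on_def using trans by blast+
  qed
  show "\<not> flag_transitive_on K (flags K)"
  proof
    assume "flag_transitive_on K (flags K)"
    then obtain g where "g \<in> carrier (aut_group K)" "flag_image g (W \<one>) = B \<one>"
      unfolding flag_transitive_on_def by (meson W_flag B_flag one_closed)
    then show False using aut_W_to_B no_reflection by blast
  qed
qed

theorem exists_tight_chiral_polyhedron:
  "\<exists>K :: nat ranked_poset. chiral K \<and> tight K p q \<and> is_aut_group_of (G, s, t) K"
proof (intro exI conjI)
  show "chiral K" by (rule chiral_K)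
  show "tight K p q"
    using polyhedron_K has_type_K card_flags_K by (simp add: tight_def)
  \<comment> \<open>With base flag \<open>W \<one>\<close>, the images are \<open>W s\<close> and
    \<open>W t\<close>.\<close>
  have "flag_image (act s) (W \<one>) = adj_flag K 0 (adj_flag K 1 (W \<one>))"
    "flag_image (act t) (W \<one>) = adj_flag K 1 (adj_flag K 2 (W \<one>))"
    using s_closed t_closed by (simp_all add: adj_flag_W adj_flag_B) (simp_all add: Sp_def Tp_def)
  then show "is_aut_group_of (G, s, t) K"
    using act_iso W_flag[OF one_closed] by auto
qed

end

section \<open>The mix\<close>

lemma DirProd_int_pow:
  assumes "group G" "group H" "a \<in> carrier G" "b \<in> carrier H"
  shows "(a, b) [^]\<^bsub>G \<times>\<times> H\<^esub> (k::int) = (a [^]\<^bsub>G\<^esub> k, b [^]\<^bsub>H\<^esub> k)"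
proof -
  interpret G: group G by fact
  interpret H: group H by fact
  have nat: "(a, b) [^]\<^bsub>G \<times>\<times> H\<^esub> (n::nat) = (a [^]\<^bsub>G\<^esub> n, b [^]\<^bsub>H\<^esub> n)" for n
    by (induction n) simp_all
  interpret GH: group "G \<times>\<times> H" by (rule DirProd_group) fact+
  show ?thesis
  proof (cases k rule: int_cases2)
    case (nonneg n)
    then show ?thesis by (simp add: int_pow_int nat)
  next
    case (nonpos n)
    then show ?thesis
      using assms by (simp add: GH.int_pow_neg_int G.int_pow_neg_int H.int_pow_neg_int nat)
  qed
qed

lemma Gamma_mix_chiral_tight:
  fixes M :: int
  defines "R1 \<equiv> Gamma_rels (16 * M) (32 * M) (-1 + 8 * M) (-3 + 8 * M) (1 + 8 * M) (3 + 8 * M)"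
    and "R2 \<equiv> Gamma_rels (32 * M) 8 (-1 + 8 * M) (-3) (1 + 8 * M) 3"
  defines "\<sigma> \<equiv> (word_class R1 [(Sigma1, True)], word_class R2 [(Sigma1, True)])"
    and "\<tau> \<equiv> (word_class R1 [(Sigma2, True)], word_class R2 [(Sigma2, True)])"
  assumes M_pos: "M > 0" and coprime_3_M: "coprime 3 (32 * M)"
  shows "chiral_tight_rotation_group
    (subgroup_generated (presented_group R1 \<times>\<times> presented_group R2) {\<sigma>, \<tau>}) \<sigma> \<tau>
    (nat (32 * M)) (nat (32 * M))"
proof -
  define D where "D = presented_group R1 \<times>\<times> presented_group R2"
  define H where "H = subgroup_generated D {\<sigma>, \<tau>}"
  interpret G1: group "presented_group R1" by (rule group_presented_group)
  interpret G2: group "presented_group R2" by (rule group_presented_group)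
  interpret D: group D unfolding D_def by (rule DirProd_group) unfold_locales
  define s1 t1 s2 t2 where "s1 = word_class R1 [(Sigma1, True)]" and "t1 = word_class R1 [(Sigma2, True)]"
    and "s2 = word_class R2 [(Sigma1, True)]" and "t2 = word_class R2 [(Sigma2, True)]"
  have closed: "s1 \<in> carrier (presented_group R1)" "t1 \<in> carrier (presented_group R1)"
    "s2 \<in> carrier (presented_group R2)" "t2 \<in> carrier (presented_group R2)"
    by (simp_all add: s1_def t1_def s2_def t2_def)
  have pairs: "\<sigma> = (s1, s2)" "\<tau> = (t1, t2)"
    by (simp_all add: \<sigma>_def \<tau>_def s1_def t1_def s2_def t2_def)
  have rels1: "s1 [^]\<^bsub>presented_group R1\<^esub> (16 * M) = \<one>\<^bsub>presented_group R1\<^esub>"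
    "t1 [^]\<^bsub>presented_group R1\<^esub> (32 * M) = \<one>\<^bsub>presented_group R1\<^esub>"
    "(s1 \<otimes>\<^bsub>presented_group R1\<^esub> t1) \<otimes>\<^bsub>presented_group R1\<^esub> (s1 \<otimes>\<^bsub>presented_group R1\<^esub> t1)
      = \<one>\<^bsub>presented_group R1\<^esub>"
    "inv\<^bsub>presented_group R1\<^esub> t1 \<otimes>\<^bsub>presented_group R1\<^esub> s1 = s1 [^]\<^bsub>presented_group R1\<^esub> (-1 + 8 * M)
      \<otimes>\<^bsub>presented_group R1\<^esub> t1 [^]\<^bsub>presented_group R1\<^esub> (-3 + 8 * M)"
    "t1 \<otimes>\<^bsub>presented_group R1\<^esub> inv\<^bsub>presented_group R1\<^esub> s1 = s1 [^]\<^bsub>presented_group R1\<^esub> (1 + 8 * M)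
      \<otimes>\<^bsub>presented_group R1\<^esub> t1 [^]\<^bsub>presented_group R1\<^esub> (3 + 8 * M)"
    unfolding s1_def t1_def R1_def by (rule Gamma_relations)+
  have rels2: "s2 [^]\<^bsub>presented_group R2\<^esub> (32 * M) = \<one>\<^bsub>presented_group R2\<^esub>"
    "t2 [^]\<^bsub>presented_group R2\<^esub> (8::int) = \<one>\<^bsub>presented_group R2\<^esub>"
    "(s2 \<otimes>\<^bsub>presented_group R2\<^esub> t2) \<otimes>\<^bsub>presented_group R2\<^esub> (s2 \<otimes>\<^bsub>presented_group R2\<^esub> t2)
      = \<one>\<^bsub>presented_group R2\<^esub>"
    "inv\<^bsub>presented_group R2\<^esub> t2 \<otimes>\<^bsub>presented_group R2\<^esub> s2 = s2 [^]\<^bsub>presented_group R2\<^esub> (-1 + 8 * M)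
      \<otimes>\<^bsub>presented_group R2\<^esub> t2 [^]\<^bsub>presented_group R2\<^esub> (-3::int)"
    "t2 \<otimes>\<^bsub>presented_group R2\<^esub> inv\<^bsub>presented_group R2\<^esub> s2 = s2 [^]\<^bsub>presented_group R2\<^esub> (1 + 8 * M)
      \<otimes>\<^bsub>presented_group R2\<^esub> t2 [^]\<^bsub>presented_group R2\<^esub> (3::int)"
    unfolding s2_def t2_def R2_def by (rule Gamma_relations)+
  have s1_pow: "s1 [^]\<^bsub>presented_group R1\<^esub> (32 * M) = \<one>\<^bsub>presented_group R1\<^esub>"
    using G1.int_pow_pow[OF closed(1), of "16 * M" 2] rels1(1) by (simp add: mult.commute)
  have t2_mult: "t2 [^]\<^bsub>presented_group R2\<^esub> (8 * l) = \<one>\<^bsub>presented_group R2\<^esub>" for l :: int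
    using G2.int_pow_pow[OF closed(4), of 8 l] rels2(2) by (simp add: mult.commute)
  \<comment> \<open>As \<open>t2\<close> has eighth power 1, the exponents -3 and 3 of the second
    group may be raised by \<open>8 * M\<close>, so both components satisfy relations with the same
    exponents.\<close>
  have t2_shift: "t2 [^]\<^bsub>presented_group R2\<^esub> (a + 8 * M) = t2 [^]\<^bsub>presented_group R2\<^esub> a" for a
    using closed(4) by (simp add: G2.int_pow_mult[OF closed(4)] t2_mult)
  have pow: "\<sigma> [^]\<^bsub>D\<^esub> (k::int) = (s1 [^]\<^bsub>presented_group R1\<^esub> k, s2 [^]\<^bsub>presented_group R2\<^esub> k)"
    "\<tau> [^]\<^bsub>D\<^esub> (k::int) = (t1 [^]\<^bsub>presented_group R1\<^esub> k, t2 [^]\<^bsub>presented_group R2\<^esub> k)" for k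
    unfolding pairs D_def using closed
    by (simp_all add: DirProd_int_pow[OF G1.group_axioms G2.group_axioms])
  have D_closed: "\<sigma> \<in> carrier D" "\<tau> \<in> carrier D" using closed by (simp_all add: D_def pairs)
  have D_inv: "inv\<^bsub>D\<^esub> \<sigma> = (inv\<^bsub>presented_group R1\<^esub> s1, inv\<^bsub>presented_group R2\<^esub> s2)"
    "inv\<^bsub>D\<^esub> \<tau> = (inv\<^bsub>presented_group R1\<^esub> t1, inv\<^bsub>presented_group R2\<^esub> t2)"
    using closed G1.group_axioms G2.group_axioms by (simp_all add: D_def pairs)
  have rel1: "inv\<^bsub>D\<^esub> \<tau> \<otimes>\<^bsub>D\<^esub> \<sigma> = \<sigma> [^]\<^bsub>D\<^esub> (-1 + 8 * M) \<otimes>\<^bsub>D\<^esub> \<tau> [^]\<^bsub>D\<^esub> (-3 + 8 * M)"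
    unfolding D_inv pow t2_shift unfolding pairs D_def using rels1(4) rels2(4) by simp
  have rel2: "\<tau> \<otimes>\<^bsub>D\<^esub> inv\<^bsub>D\<^esub> \<sigma> = \<sigma> [^]\<^bsub>D\<^esub> (1 + 8 * M) \<otimes>\<^bsub>D\<^esub> \<tau> [^]\<^bsub>D\<^esub> (3 + 8 * M)"
    unfolding D_inv pow t2_shift unfolding pairs D_def using rels1(5) rels2(5) by simp
  have invol: "(\<sigma> \<otimes>\<^bsub>D\<^esub> \<tau>) \<otimes>\<^bsub>D\<^esub> (\<sigma> \<otimes>\<^bsub>D\<^esub> \<tau>) = \<one>\<^bsub>D\<^esub>"
    unfolding pairs D_def using rels1(3) rels2(3) by simp
  have orders: "\<sigma> [^]\<^bsub>D\<^esub> (32 * M) = \<one>\<^bsub>D\<^esub>" "\<tau> [^]\<^bsub>D\<^esub> (32 * M) = \<one>\<^bsub>D\<^esub>"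
    unfolding pow using s1_pow rels1(2) rels2(1) t2_mult[of "4 * M"] by (simp_all add: D_def)
  \<comment> \<open>The relations are applied in the whole direct product \<open>D\<close>;
    \<open>generate_factors\<close> then concerns exactly the elements of \<open>H\<close>.\<close>
  interpret twisted: twisted_rotation_pair D \<sigma> \<tau> "8 * M" "32 * M"
    by unfold_locales (use D_closed invol rel1 rel2 orders coprime_3_M in simp_all)
  have carrier_H: "carrier H = generate D {\<sigma>, \<tau>}"
    using D_closed by (simp add: H_def carrier_subgroup_generated)
  have H_closed: "\<sigma> \<in> carrier H" "\<tau> \<in> carrier H"
    unfolding carrier_H by (auto intro: generate.incl)
  have H_pow: "x [^]\<^bsub>H\<^esub> (k::int) = x [^]\<^bsub>D\<^esub> k" if "x \<in> carrier H" for x k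
    using that unfolding H_def by (rule D.int_pow_subgroup_generated)
  have H_inv: "inv\<^bsub>H\<^esub> x = inv\<^bsub>D\<^esub> x" if "x \<in> carrier H" for x
    using that unfolding H_def by (rule D.inv_subgroup_generated)
  have H_ops: "\<one>\<^bsub>H\<^esub> = \<one>\<^bsub>D\<^esub>" "\<And>x y. x \<otimes>\<^bsub>H\<^esub> y = x \<otimes>\<^bsub>D\<^esub> y" by (simp_all add: H_def)
  interpret H: group H unfolding H_def by simp
  have p_eq: "int (nat (32 * M)) = 32 * M" using M_pos by simp
  interpret tight: tight_rotation_group H \<sigma> \<tau> "nat (32 * M)" "nat (32 * M)"
  proof unfold_locales
    show "\<exists>(i::int) (j::int). x = \<sigma> [^]\<^bsub>H\<^esub> i \<otimes>\<^bsub>H\<^esub> \<tau> [^]\<^bsub>H\<^esub> j" if "x \<in> carrier H" for x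
      using that twisted.generate_factors unfolding carrier_H[symmetric]
      by (simp add: H_pow H_closed H_ops)
    show "int (nat (32 * M)) dvd i \<and> int (nat (32 * M)) dvd j"
      if eq: "\<sigma> [^]\<^bsub>H\<^esub> i = \<tau> [^]\<^bsub>H\<^esub> j" for i j :: int
    proof
      have "word_class R1 (gen_pow Sigma1 i) = word_class R1 (gen_pow Sigma2 j)"
        "word_class R2 (gen_pow Sigma1 i) = word_class R2 (gen_pow Sigma2 j)"
        using eq by (simp_all add: H_pow H_closed pow word_class_gen_pow s1_def s2_def t1_def t2_def)
      \<comment> \<open>Each model is evaluated at 0, the fixed point of its generator that does not
        translate. The first yields the divisibility of \<open>j\<close>, the second that of
        \<open>i\<close>.\<close>
      then have "[face_action M i 0 = 0 + j] (mod 32 * M)" "[0 + i = vertex_action M j 0] (mod 32 * M)"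
        using Gamma_model.gen_pow_eq_imp_cong[OF Gamma_model_faces, of M i j 0]
          Gamma_model.gen_pow_eq_imp_cong[OF Gamma_model_vertices, of M i j 0]
        by (simp_all add: R1_def R2_def)
      then show "int (nat (32 * M)) dvd i" "int (nat (32 * M)) dvd j"
        unfolding p_eq by (simp_all add: face_action_0 vertex_action_0 cong_0_iff cong_sym_eq[of 0])
    qed
  qed (use M_pos invol orders H_closed in \<open>simp_all add: H_pow H_ops\<close>)
  \<comment> \<open>The sum is \<open>16 * M\<close>, which lies strictly between 0 and
    \<open>32 * M\<close>.\<close>
  have "\<not> int (nat (32 * M)) dvd (-1 + 8 * M) + (1 + 8 * M)"
    unfolding p_eq using M_pos by (auto dest: zdvd_imp_le)
  then have "chiral_tight_rotation_group H \<sigma> \<tau> (nat (32 * M)) (nat (32 * M))"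
    using tight.no_reflection_criterion[of "-1 + 8 * M" "-3 + 8 * M" "1 + 8 * M" "3 + 8 * M"] rel1 rel2
    by unfold_locales (simp add: H_pow H_inv H_closed H_ops)
  then show ?thesis by (simp add: H_def D_def)
qed

theorem theorem3p12:
  fixes \<alpha> :: nat and \<Gamma>1 \<Gamma>2 :: "gen word set gen_group"
  assumes "\<alpha> \<ge> 5"
    and "\<Gamma>1 = Gamma (2 ^ (\<alpha> - 1)) (2 ^ \<alpha>)
                 (-1 + 2 ^ (\<alpha> - 2)) (-3 + 2 ^ (\<alpha> - 2)) (1 + 2 ^ (\<alpha> - 2)) (3 + 2 ^ (\<alpha> - 2))"
    and "\<Gamma>2 = Gamma (2 ^ \<alpha>) 8 (-1 + 2 ^ (\<alpha> - 2)) (-3) (1 + 2 ^ (\<alpha> - 2)) 3"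
  shows "\<exists>K :: nat ranked_poset.
           chiral K \<and> tight K (2 ^ \<alpha>) (2 ^ \<alpha>) \<and> is_aut_group_of (\<Gamma>1 \<diamondop> \<Gamma>2) K"
proof -
  \<comment> \<open>For \<open>\<alpha> \<ge> 5\<close> the powers of 2 in the parameters become
    \<open>8 * M\<close>, \<open>16 * M\<close> and \<open>32 * M\<close>, as in the two
    models.\<close>
  define M :: int where "M = 2 ^ (\<alpha> - 5)"
  obtain n where n: "\<alpha> = n + 5" using assms(1) by (metis add.commute le_Suc_ex)
  have pows: "2 ^ (\<alpha> - 1) = 16 * M" "2 ^ \<alpha> = 32 * M" "2 ^ (\<alpha> - 2) = 8 * M"
    by (simp_all add: M_def n power_add numeral_eq_Suc)
  have "coprime (3::int) (2 ^ \<alpha>)" by simp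
  then have "coprime 3 (32 * M)" by (simp only: pows)
  have "M > 0" by (simp add: M_def)
  have size: "nat (32 * M) = 2 ^ \<alpha>" by (simp add: pows(2)[symmetric] nat_power_eq)
  have "\<exists>K :: nat ranked_poset. chiral K \<and> tight K (nat (32 * M)) (nat (32 * M)) \<and>
      is_aut_group_of (\<Gamma>1 \<diamondop> \<Gamma>2) K"
    unfolding assms(2,3) Gamma_def Let_def pows mix.simps
    by (rule chiral_tight_rotation_group.exists_tight_chiral_polyhedron[OF Gamma_mix_chiral_tight]) fact+
  then show ?thesis unfolding size .
qed

end
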